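(* The value function of Problem $\mathcal{OPT}^M$ is identical to the value function of Problem $\mathcal{OPT}$, i.e. $V^M_k(x_k,r_k)=V_k(x_k,r_k)$ for all $k\in\{0,\ldots,N\}$, $x_k\in S$ and $r_k\in\mathbb R$. Furthermore, Problem $\mathcal{OPT}^M$ is a time consistent stochastic optimal control problem.
   Context: **MDP.** A finite Markov decision process has a finite state space $S$, a finite control space $U$, a nonempty set $U(x)\subseteq U$ of admissible controls for each $x\in S$, and a transition probability $Q(\cdot|x,u)$ on $S$ for each $x\in S$, $u\in U(x)$. A history up to time $k$ is $h_{0,k}=(x_0,u_0,\ldots,x_{k-1},u_{k-1},x_k)$. $\Pi$ is the set of deterministic history-dependent policies $\pi=\{\pi_0,\pi_1,\ldots\}$ with $\pi_k(h_{0,k})\in U(x_k)$. For $k\ge 0$, with sub-histories $h_{k,j}=(x_k,u_k,\ldots,x_j)$, $\Pi_k$ is the set of truncated policies $\{\pi_k,\pi_{k+1},\ldots\}$ with $\pi_j(h_{k,j})\in U(x_j)$ for $j\ge k$. **Risk.** Let $\mathcal Z_k=L_p(\Omega,\mathcal F_k,P)$, $p\in[1,\infty]$, for a filtration $(\mathcal F_k)$. A coherent one-step conditional risk measure is a map $\rho_k:\mathcal Z_{k+1}\to\mathcal Z_k$ such that: $\rho_k(\lambda Z+(1-\lambda)W)\le\lambda\rho_k(Z)+(1-\lambda)\rho_k(W)$ for $\lambda\in[0,1]$; $Z\le W$ implies $\rho_k(Z)\le\rho_k(W)$; $\rho_k(Z+W)=Z+\rho_k(W)$ for $Z\in\mathcal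 Z_k$, $W\in\mathcal Z_{k+1}$; $\rho_k(\lambda Z)=\lambda\rho_k(Z)$ for $\lambda\ge0$. A dynamic time-consistent risk measure is $$\rho_{k,N}(Z_k,\ldots,Z_N)=Z_k+\rho_k(Z_{k+1}+\rho_{k+1}(Z_{k+2}+\cdots+\rho_{N-1}(Z_N)\cdots)).$$ It is a Markov dynamic risk measure if for every function $V$ on $S$ one has $\rho_k(V(x_{k+1}))=\sigma_k(V(x_{k+1}),x_k,Q(x_{k+1}|x_k,u_k))$, with $\sigma_k$ a coherent one-step conditional risk measure on functions on $S$; i.e. the evaluation depends only on the function $V$, the current state $x_k$ and the transition law $Q(\cdot|x_k,u_k)$. Throughout, $\rho_{k,N}$ is a Markov dynamic risk measure. **Problem $\mathcal{OPT}$.** Fix a horizon $N\ge1$ and cost functions $c,d:S\times U\to\mathbb R$. For a policy $\pi$ and stage $k$, $$J_N^\pi(x_k)=\mathbb E\Big[\sum_{j=k}^{N-1}c(x_j,u_j)\Big],\qquad R_N^\pi(x_k)=\rho_{k,N}(d(x_k,u_k),\ldots,d(x_{N-1},u_{N-1}),0),$$ where the controls are generated by $\pi$. Problem $\mathcal{OPT}$: given $x_0\in S$, $r_0\in\mathbb R$, minimize $J_N^\pi(x_0)$ over $\pi\in\Pi$ subject to $R_N^\pi(x_0)\le r_0$. Let $\underline R_N(x_k)=\min_{\pi\in\Pi_k}R_N^\pi(x_k)$, $\Phi_k(x_k)=[\underline R_N(x_k),\infty)$ for $k<N$, and $\Phi_N(x_N)=[0,\infty)$. The value functions of $\mathcal{OPT}$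 are: for $k<N$ and $r_k\in\Phi_k(x_k)$, $V_k(x_k,r_k)=\min\{J_N^\pi(x_k):\pi\in\Pi_k,\ R_N^\pi(x_k)\le r_k\}$; for $k\le N$ and $r_k\notin\Phi_k(x_k)$, $V_k(x_k,r_k)=\infty$; and $V_N(x_N,r_N)=0$ for $r_N\in\Phi_N(x_N)$. **Problem $\mathcal{OPT}^M$.** Let $\Pi^m_k$ be the set of augmented state-feedback policies $\{\pi_k,\ldots,\pi_{N-1}\}$, where $\pi_j$ maps a pair $(x_j,r_j)$ with $x_j\in S$, $r_j\in\Phi_j(x_j)$ to a control $\pi_j(x_j,r_j)\in U(x_j)$. Let $\mathfrak R_k$ be the set of risk-to-go updates $\{\mathcal R_{k+1},\ldots,\mathcal R_N\}$, where $\mathcal R_{j+1}(x_j,r_j)(x_{j+1})=r_{j+1}-r_j$ with $r_{j+1}\in\Phi_{j+1}(x_{j+1})$, $j\in\{k,\ldots,N-1\}$. For $k\in\{0,\ldots,N-1\}$, $x_k\in S$, $r_k\in\Phi_k(x_k)$, the $k$-tail subproblem of $\mathcal{OPT}^M$ is: minimize $J_N^\pi(x_k)$ over $\pi\in\Pi_k^m$, $\mathcal R\in\mathfrak R_k$ subject to, for all $j\in\{k,\ldots,N-1\}$, $$\rho_j\big(r_{j+1}+d(x_j,\pi_j(x_j,r_j))\big)=r_j,\qquad r_{j+1}=\mathcal R_{j+1}(x_j,r_j)(x_{j+1})+r_j,\qquad 0\le r_N ;$$ its optimal value is $V^M_k(x_k,r_k)$. For $k\le N$ and $r_k\notin\Phi_k(x_k)$,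 $V_k^M(x_k,r_k)=\infty$; and $V_N^M(x_N,r_N)=0$ for $r_N\in\Phi_N(x_N)$. Problem $\mathcal{OPT}^M$ itself is the case $k=0$. **Time consistency.** For any given initial state $x_0\in S$ and risk threshold $r_0\in\Phi_0(x_0)$, let $\pi^\ast=\{\pi_0^\ast,\ldots,\pi^\ast_{N-1}\}\in\Pi^m_0$ be a sequence of optimal policy and $r^\ast=\{r_1^\ast,\ldots,r_N^\ast\}$ a sequence of (optimal) risk-to-go for Problem $\mathcal{OPT}^M$. Problem $\mathcal{OPT}^M$ is a time consistent stochastic optimal control problem if, at any $k\in\{0,\ldots,N-1\}$, the $k$-subsequences $\{\pi^\ast_k,\ldots,\pi^\ast_{N-1}\}$ and $\{r^\ast_{k+1},\ldots,r^\ast_N\}$ are sequences of optimal solution to the $k$-tail subproblem of Problem $\mathcal{OPT}^M$ at initial state $x_k\in S$ and risk threshold $r_k\in\Phi_k(x_k)$. In this case $\pi^\ast$ is called a time consistent optimal policy.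
   Formalization: Time consistency is stated at the states x_k and risk-to-go thresholds r_k that the optimal solution reaches almost surely, not at every x_k in S and r_k in Φ_k(x_k); for all pairs it is false, since an optimal solution from (x_0,r_0) is arbitrary in cost at pairs it never visits. *)

theory Defs
  imports "HOL-Probability.Probability"
begin

section \<open>Coherent one-step conditional risk measures and their composition\<close>

definition Lp_space :: "ennreal \<Rightarrow> 'w measure \<Rightarrow> 'w measure \<Rightarrow> ('w \<Rightarrow> real) set" where
  "Lp_space p P F = {Z \<in> borel_measurable F.
     if p = \<infinity> then \<exists>C. AE \<omega> in P. \<bar>Z \<omega>\<bar> \<le> C
     else integrable P (\<lambda>\<omega>. \<bar>Z \<omega>\<bar> powr enn2real p)}"

text \<open>Elements of an \<open>L\<^sub>p\<close> space are represented by functions, and all (in)equalities between them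
  are \<open>P\<close>-almost sure. By monotonicity, such a map respects almost sure equality.\<close>

definition coherent_one_step ::
  "ennreal \<Rightarrow> 'w measure \<Rightarrow> 'w measure \<Rightarrow> 'w measure \<Rightarrow> (('w \<Rightarrow> real) \<Rightarrow> 'w \<Rightarrow> real) \<Rightarrow> bool" where
  "coherent_one_step p P F G \<rho> \<longleftrightarrow>
     (\<forall>Z \<in> Lp_space p P G. \<rho> Z \<in> Lp_space p P F) \<and>
     (\<forall>Z \<in> Lp_space p P G. \<forall>W \<in> Lp_space p P G. \<forall>l \<in> {0..1}. AE \<omega> in P.
        \<rho> (\<lambda>\<omega>. l * Z \<omega> + (1 - l) * W \<omega>) \<omega> \<le> l * \<rho> Z \<omega> + (1 - l) * \<rho> W \<omega>) \<and>
     (\<forall>Z \<in> Lp_space p P G. \<forall>W \<in> Lp_space p P G.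
        (AE \<omega> in P. Z \<omega> \<le> W \<omega>) \<longrightarrow> (AE \<omega> in P. \<rho> Z \<omega> \<le> \<rho> W \<omega>)) \<and>
     (\<forall>Z \<in> Lp_space p P F. \<forall>W \<in> Lp_space p P G. AE \<omega> in P.
        \<rho> (\<lambda>\<omega>. Z \<omega> + W \<omega>) \<omega> = Z \<omega> + \<rho> W \<omega>) \<and>
     (\<forall>Z \<in> Lp_space p P G. \<forall>l \<ge> 0. AE \<omega> in P. \<rho> (\<lambda>\<omega>. l * Z \<omega>) \<omega> = l * \<rho> Z \<omega>)"

definition coherent_functional :: "(('s \<Rightarrow> real) \<Rightarrow> real) \<Rightarrow> bool" where
  "coherent_functional \<sigma> \<longleftrightarrow>
     (\<forall>V W. \<forall>l \<in> {0..1}. \<sigma> (\<lambda>x. l * V x + (1 - l) * W x) \<le> l * \<sigma> V + (1 - l) * \<sigma> W) \<and>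
     (\<forall>V W. (\<forall>x. V x \<le> W x) \<longrightarrow> \<sigma> V \<le> \<sigma> W) \<and>
     (\<forall>a V. \<sigma> (\<lambda>x. a + V x) = a + \<sigma> V) \<and>
     (\<forall>V. \<forall>l \<ge> 0. \<sigma> (\<lambda>x. l * V x) = l * \<sigma> V)"

text \<open>\<open>dyn_risk \<rho> Z k n\<close> is \<open>\<rho>\<^bsub>k,k+n\<^esub>(Z\<^sub>k, \<dots>, Z\<^bsub>k+n\<^esub>)\<close>.\<close>

primrec dyn_risk ::
  "(nat \<Rightarrow> ('w \<Rightarrow> real) \<Rightarrow> 'w \<Rightarrow> real) \<Rightarrow> (nat \<Rightarrow> 'w \<Rightarrow> real) \<Rightarrow> nat \<Rightarrow> nat \<Rightarrow> 'w \<Rightarrow> real" where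
  "dyn_risk \<rho> Z k 0 = Z k"
| "dyn_risk \<rho> Z k (Suc n) = (\<lambda>\<omega>. Z k \<omega> + \<rho> k (dyn_risk \<rho> Z (Suc k) n) \<omega>)"

section \<open>Markov decision processes\<close>

text \<open>A trajectory is \<open>\<omega> = ((x\<^sub>0,u\<^sub>0), (x\<^sub>1,u\<^sub>1), \<dots>)\<close>. The history \<open>h\<^bsub>k,j\<^esub>\<close> is the pair
  \<open>([(x\<^sub>k,u\<^sub>k), \<dots>, (x\<^bsub>j-1\<^esub>,u\<^bsub>j-1\<^esub>)], x\<^sub>j)\<close>.\<close>

type_synonym ('s, 'u) traj = "nat \<Rightarrow> 's \<times> 'u"
type_synonym ('s, 'u) history = "('s \<times> 'u) list \<times> 's"
type_synonym ('s, 'u) policy = "nat \<Rightarrow> ('s, 'u) history \<Rightarrow> 'u"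

text \<open>The law of the trajectory depends on the policy, hence so do the \<open>L\<^sub>p\<close> spaces on which the
  one-step risk measures act: \<open>risk M P k\<close> is \<open>\<rho>\<^sub>k\<close> under the trajectory law \<open>P\<close>.
  The values \<open>kernel M x u\<close> with \<open>u \<notin> adm M x\<close> play no role.\<close>

record ('s, 'u) problem =
  adm :: "'s \<Rightarrow> 'u set"
  kernel :: "'s \<Rightarrow> 'u \<Rightarrow> 's pmf"
  horizon :: nat
  cost :: "'s \<Rightarrow> 'u \<Rightarrow> real"
  risk_cost :: "'s \<Rightarrow> 'u \<Rightarrow> real"
  exponent :: ennreal
  risk :: "('s, 'u) traj pmf \<Rightarrow> nat \<Rightarrow> (('s, 'u) traj \<Rightarrow> real) \<Rightarrow> ('s, 'u) traj \<Rightarrow> real"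

definition state :: "nat \<Rightarrow> ('s, 'u) traj \<Rightarrow> 's" where
  "state j \<omega> = fst (\<omega> j)"

definition hist :: "nat \<Rightarrow> nat \<Rightarrow> ('s, 'u) traj \<Rightarrow> ('s, 'u) history" where
  "hist k j \<omega> = (map \<omega> [k..<j], state j \<omega>)"

definition filtration :: "nat \<Rightarrow> ('s, 'u) traj measure" where
  "filtration j = vimage_algebra UNIV (hist 0 j) (count_space UNIV)"

definition policies :: "('s, 'u) problem \<Rightarrow> nat \<Rightarrow> ('s, 'u) policy set" where
  "policies M k = {\<pi>. \<forall>j \<ge> k. \<forall>h. length (fst h) = j - k \<longrightarrow> \<pi> j h \<in> adm M (snd h)}"

text \<open>The control at time \<open>j\<close> is written as a function of the history rather than as the coordinate
  \<open>snd (\<omega> j)\<close>, with which it agrees almost surely, so that it is measurable with respect to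
  \<open>filtration j\<close>.\<close>

definition control :: "('s, 'u) policy \<Rightarrow> nat \<Rightarrow> nat \<Rightarrow> ('s, 'u) traj \<Rightarrow> 'u" where
  "control \<pi> k j \<omega> = \<pi> j (hist k j \<omega>)"

text \<open>The process is started at time \<open>k\<close> in state \<open>x\<close> and controlled by \<open>\<pi>\<close>. Coordinates which
  have not been generated (times before \<open>k\<close>, times after the last step, and the control at the
  last step) are filled with \<open>undefined\<close>.\<close>

primrec steps_law ::
  "('s, 'u) problem \<Rightarrow> nat \<Rightarrow> ('s, 'u) policy \<Rightarrow> 's \<Rightarrow> nat \<Rightarrow> ('s, 'u) traj pmf" where
  "steps_law M k \<pi> x 0 = return_pmf ((\<lambda>_. undefined)(k := (x, undefined)))"
| "steps_law M k \<pi> x (Suc n) =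
     bind_pmf (steps_law M k \<pi> x n) (\<lambda>w.
       let y = state (k + n) w; u = control \<pi> k (k + n) w
       in map_pmf (\<lambda>z. w(k + n := (y, u), Suc (k + n) := (z, undefined))) (kernel M y u))"

definition law :: "('s, 'u) problem \<Rightarrow> nat \<Rightarrow> ('s, 'u) policy \<Rightarrow> 's \<Rightarrow> ('s, 'u) traj pmf" where
  "law M k \<pi> x = steps_law M k \<pi> x (horizon M - k)"

definition markov_dynamic_risk :: "('s, 'u) problem \<Rightarrow> bool" where
  "markov_dynamic_risk M \<longleftrightarrow>
     (\<exists>\<sigma> :: nat \<Rightarrow> ('s \<Rightarrow> real) \<Rightarrow> 's \<Rightarrow> 's pmf \<Rightarrow> real.
        (\<forall>j x q. coherent_functional (\<lambda>V. \<sigma> j V x q)) \<and>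
        (\<forall>k < horizon M. \<forall>x. \<forall>\<pi> \<in> policies M k. \<forall>j \<in> {k..<horizon M}.
           let P = law M k \<pi> x in
           coherent_one_step (exponent M) (measure_pmf P) (filtration j) (filtration (Suc j))
             (risk M P j) \<and>
           (\<forall>V. AE \<omega> in measure_pmf P.
              risk M P j (\<lambda>\<omega>. V (state (Suc j) \<omega>)) \<omega> =
              \<sigma> j V (state j \<omega>) (kernel M (state j \<omega>) (control \<pi> k j \<omega>)))))"

section \<open>The problem OPT\<close>

definition J :: "('s, 'u) problem \<Rightarrow> nat \<Rightarrow> ('s, 'u) policy \<Rightarrow> 's \<Rightarrow> real" where
  "J M k \<pi> x = measure_pmf.expectation (law M k \<pi> x)
     (\<lambda>\<omega>. \<Sum>j = k..<horizon M. cost M (state j \<omega>) (control \<pi> k j \<omega>))"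

definition stage_risk_cost ::
  "('s, 'u) problem \<Rightarrow> nat \<Rightarrow> ('s, 'u) policy \<Rightarrow> nat \<Rightarrow> ('s, 'u) traj \<Rightarrow> real" where
  "stage_risk_cost M k \<pi> j \<omega> =
     (if j < horizon M then risk_cost M (state j \<omega>) (control \<pi> k j \<omega>) else 0)"

text \<open>\<open>\<rho>\<^bsub>k,N\<^esub>(\<dots>)\<close> is a random variable measurable with respect to the history up to time \<open>k\<close>, hence
  almost surely constant when the process is started at time \<open>k\<close> in the state \<open>x\<close>; \<open>R\<close> is that
  constant.\<close>

definition R :: "('s, 'u) problem \<Rightarrow> nat \<Rightarrow> ('s, 'u) policy \<Rightarrow> 's \<Rightarrow> real" where
  "R M k \<pi> x = (THE v. AE \<omega> in measure_pmf (law M k \<pi> x).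
     dyn_risk (risk M (law M k \<pi> x)) (stage_risk_cost M k \<pi>) k (horizon M - k) \<omega> = v)"

text \<open>Up to their values on histories that do not occur within the horizon there are only finitely many
  policies, so
  the infima in \<open>R_min\<close> and \<open>V\<close> below are minima.\<close>

definition R_min :: "('s, 'u) problem \<Rightarrow> nat \<Rightarrow> 's \<Rightarrow> real" where
  "R_min M k x = (INF \<pi> \<in> policies M k. R M k \<pi> x)"

definition \<Phi> :: "('s, 'u) problem \<Rightarrow> nat \<Rightarrow> 's \<Rightarrow> real set" where
  "\<Phi> M k x = (if k < horizon M then {R_min M k x..} else {0..})"

definition V :: "('s, 'u) problem \<Rightarrow> nat \<Rightarrow> 's \<Rightarrow> real \<Rightarrow> ereal" where
  "V M k x r =
     (if r \<notin> \<Phi> M k x then \<infinity>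
      else if k < horizon M then INF \<pi> \<in> {\<pi> \<in> policies M k. R M k \<pi> x \<le> r}. ereal (J M k \<pi> x)
      else 0)"

section \<open>The problem OPT-M\<close>

text \<open>Sequences such as \<open>\<pi>\<^sub>k, \<dots>, \<pi>\<^bsub>N-1\<^esub>\<close> and \<open>\<R>\<^bsub>k+1\<^esub>, \<dots>, \<R>\<^sub>N\<close> are families indexed by absolute time,
  of which only the listed members are used. In particular the subsequences starting at a later
  time are represented by the same families.\<close>

type_synonym ('s, 'u) aug_policy = "nat \<Rightarrow> 's \<Rightarrow> real \<Rightarrow> 'u"
type_synonym 's update = "nat \<Rightarrow> 's \<Rightarrow> real \<Rightarrow> 's \<Rightarrow> real"

definition aug_policies :: "('s, 'u) problem \<Rightarrow> nat \<Rightarrow> ('s, 'u) aug_policy set" where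
  "aug_policies M k = {\<pi>. \<forall>j \<in> {k..<horizon M}. \<forall>x. \<forall>r \<in> \<Phi> M j x. \<pi> j x r \<in> adm M x}"

definition updates :: "('s, 'u) problem \<Rightarrow> nat \<Rightarrow> 's update set" where
  "updates M k = {\<R>. \<forall>j \<in> {k..<horizon M}. \<forall>x. \<forall>r \<in> \<Phi> M j x. \<forall>y.
     \<R> (Suc j) x r y + r \<in> \<Phi> M (Suc j) y}"

text \<open>\<open>risk_to_go \<R> k r [x\<^sub>k, \<dots>, x\<^sub>j]\<close> is the threshold \<open>r\<^sub>j\<close> obtained from \<open>r\<^sub>k = r\<close> by
  \<open>r\<^bsub>i+1\<^esub> = \<R>\<^bsub>i+1\<^esub>(x\<^sub>i,r\<^sub>i)(x\<^bsub>i+1\<^esub>) + r\<^sub>i\<close>.\<close>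

fun risk_to_go :: "'s update \<Rightarrow> nat \<Rightarrow> real \<Rightarrow> 's list \<Rightarrow> real" where
  "risk_to_go \<R> k r (x # y # xs) = risk_to_go \<R> (Suc k) (\<R> (Suc k) x r y + r) (y # xs)"
| "risk_to_go \<R> k r _ = r"

definition threshold :: "'s update \<Rightarrow> nat \<Rightarrow> real \<Rightarrow> nat \<Rightarrow> ('s, 'u) traj \<Rightarrow> real" where
  "threshold \<R> k r j \<omega> = risk_to_go \<R> k r (map (\<lambda>i. state i \<omega>) [k..<Suc j])"

text \<open>The history-dependent policy by which \<open>(\<pi>, \<R>)\<close> acts when started at time \<open>k\<close> with the
  threshold \<open>r\<close>.\<close>

definition induced ::
  "('s, 'u) aug_policy \<Rightarrow> 's update \<Rightarrow> nat \<Rightarrow> real \<Rightarrow> ('s, 'u) policy" where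
  "induced \<pi> \<R> k r j h = \<pi> j (snd h) (risk_to_go \<R> k r (map fst (fst h) @ [snd h]))"

definition aug_law ::
  "('s, 'u) problem \<Rightarrow> nat \<Rightarrow> 's \<Rightarrow> real \<Rightarrow> ('s, 'u) aug_policy \<Rightarrow> 's update \<Rightarrow> ('s, 'u) traj pmf" where
  "aug_law M k x r \<pi> \<R> = law M k (induced \<pi> \<R> k r) x"

definition feasible ::
  "('s, 'u) problem \<Rightarrow> nat \<Rightarrow> 's \<Rightarrow> real \<Rightarrow> ('s, 'u) aug_policy \<Rightarrow> 's update \<Rightarrow> bool" where
  "feasible M k x r \<pi> \<R> \<longleftrightarrow>
     \<pi> \<in> aug_policies M k \<and> \<R> \<in> updates M k \<and>
     (let P = aug_law M k x r \<pi> \<R>; rr = threshold \<R> k r in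
      (\<forall>j \<in> {k..<horizon M}. AE \<omega> in measure_pmf P.
         risk M P j (\<lambda>\<omega>. rr (Suc j) \<omega>
           + risk_cost M (state j \<omega>) (\<pi> j (state j \<omega>) (rr j \<omega>))) \<omega> = rr j \<omega>) \<and>
      (AE \<omega> in measure_pmf P. 0 \<le> rr (horizon M) \<omega>))"

definition J_aug ::
  "('s, 'u) problem \<Rightarrow> nat \<Rightarrow> 's \<Rightarrow> real \<Rightarrow> ('s, 'u) aug_policy \<Rightarrow> 's update \<Rightarrow> real" where
  "J_aug M k x r \<pi> \<R> = J M k (induced \<pi> \<R> k r) x"

definition VM :: "('s, 'u) problem \<Rightarrow> nat \<Rightarrow> 's \<Rightarrow> real \<Rightarrow> ereal" where
  "VM M k x r =
     (if r \<notin> \<Phi> M k x then \<infinity>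
      else if k < horizon M then
        INF (\<pi>, \<R>) \<in> {(\<pi>, \<R>). feasible M k x r \<pi> \<R>}. ereal (J_aug M k x r \<pi> \<R>)
      else 0)"

definition optimal ::
  "('s, 'u) problem \<Rightarrow> nat \<Rightarrow> 's \<Rightarrow> real \<Rightarrow> ('s, 'u) aug_policy \<Rightarrow> 's update \<Rightarrow> bool" where
  "optimal M k x r \<pi> \<R> \<longleftrightarrow>
     feasible M k x r \<pi> \<R> \<and>
     (\<forall>\<pi>' \<R>'. feasible M k x r \<pi>' \<R>' \<longrightarrow> J_aug M k x r \<pi> \<R> \<le> J_aug M k x r \<pi>' \<R>')"

text \<open>The tail subproblem at time \<open>k\<close> is posed at the state and the threshold which the optimal
  solution has reached at time \<open>k\<close>, for almost every trajectory. An optimal solution is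
  unconstrained at pairs that it never visits, so its tails need not be optimal there.\<close>

definition time_consistent :: "('s, 'u) problem \<Rightarrow> bool" where
  "time_consistent M \<longleftrightarrow>
     (\<forall>x\<^sub>0. \<forall>r\<^sub>0 \<in> \<Phi> M 0 x\<^sub>0. \<forall>\<pi> \<R>. optimal M 0 x\<^sub>0 r\<^sub>0 \<pi> \<R> \<longrightarrow>
        (\<forall>k < horizon M. AE \<omega> in measure_pmf (aug_law M 0 x\<^sub>0 r\<^sub>0 \<pi> \<R>).
           threshold \<R> 0 r\<^sub>0 k \<omega> \<in> \<Phi> M k (state k \<omega>) \<and>
           optimal M k (state k \<omega>) (threshold \<R> 0 r\<^sub>0 k \<omega>) \<pi> \<R>))"

end

(* The law of the process decomposes at the first step, and locality turns the one-step risk of any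
   function of the history into sigma applied to a function of the next state. Hence cost and risk of
   a policy obey backward recursions through its continuations. Only finitely many pairs (risk, cost)
   occur, so minima are attained. Continuations of an optimal policy supply risk-to-go updates, whose
   slack is absorbed by adding a constant; this gives one augmented policy that is optimal at every
   state and threshold, so VM <= V. Conversely, a feasible augmented policy induces a history-dependent
   policy whose risk is at most the threshold. Finally, if a tail of an optimal solution were improvable
   at a successor of positive probability, pasting in the better tail would beat the optimum. *)

theory Submission
  imports Defs
begin

section \<open>Trajectory laws\<close>

text \<open>The time index \<open>j\<close> stays absolute and only the history is extended, so a
  policy started at time \<open>k\<close> yields its continuation after the steps \<open>l\<close>
  without re-indexing.\<close>

definition after :: "('s \<times> 'u) list \<Rightarrow> ('s, 'u) policy \<Rightarrow> ('s, 'u) policy" where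
  "after l \<pi> j h = \<pi> j (l @ fst h, snd h)"

definition start :: "('s, 'u) history \<Rightarrow> 's" where
  "start h = hd (map fst (fst h) @ [snd h])"

lemma after_Nil [simp]: "after [] \<pi> = \<pi>"
  by (intro ext) (simp add: after_def)

lemma after_after [simp]: "after l' (after l \<pi>) = after (l @ l') \<pi>"
  by (intro ext) (simp add: after_def)

lemma after_in_policies:
  assumes "\<pi> \<in> policies M k"
  shows "after [p] \<pi> \<in> policies M (Suc k)"
  using assms unfolding policies_def after_def
  by (auto simp: Suc_diff_le le_Suc_eq)

lemma hist_fun_upd:
  assumes "k < j"
  shows "hist k j (w(k := p)) = (p # fst (hist (Suc k) j w), snd (hist (Suc k) j w))"
  using assms by (auto simp: hist_def state_def upt_conv_Cons)

lemma control_fun_upd: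
  assumes "k < j"
  shows "control \<pi> k j (w(k := p)) = control (after [p] \<pi>) (Suc k) j w"
  using assms by (simp add: control_def hist_fun_upd after_def)

lemma state_fun_upd: "state j (w(k := p)) = (if j = k then fst p else state j w)"
  by (simp add: state_def)

lemma control_initial: "control \<pi> k k w = \<pi> k ([], state k w)"
  by (simp add: control_def hist_def)

text \<open>\<open>steps_law\<close> grows trajectories at their end, whereas backward recursion
  needs the first step split off. Appending a later step depends on coordinate \<open>k\<close> only
  through the policy, where \<open>after\<close> absorbs it; the tail law leaves that coordinate
  undefined and it is filled in afterwards.\<close>

lemma steps_law_Suc_first:
  fixes \<pi> :: "('s, 'u) policy" and k :: nat
  defines "p \<equiv> \<lambda>x. (x, \<pi> k ([], x))"
  shows "steps_law M k \<pi> x (Suc n) =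
    bind_pmf (kernel M x (\<pi> k ([], x)))
      (\<lambda>y. map_pmf (\<lambda>w. w(k := p x)) (steps_law M (Suc k) (after [p x] \<pi>) y n))"
proof (induction n)
  case 0
  have "control \<pi> k k ((\<lambda>_. undefined)(k := (x, undefined))) = \<pi> k ([], x)"
    by (simp add: control_initial state_def)
  then show ?case
    by (simp add: bind_return_pmf state_def Let_def map_pmf_def p_def fun_upd_twist
      fun_upd_same del: fun_upd_apply)
next
  case (Suc n)
  define g where "g = (\<lambda>w::('s, 'u) traj. w(k := p x))"
  define F where "F = (\<lambda>w. let y = state (k + Suc n) w; u = control \<pi> k (k + Suc n) w
       in map_pmf (\<lambda>z. w(k + Suc n := (y, u), Suc (k + Suc n) := (z, undefined))) (kernel M y u))"
  define F' where "F' = (\<lambda>w. let y = state (Suc k + n) w;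
         u = control (after [p x] \<pi>) (Suc k) (Suc k + n) w
       in map_pmf (\<lambda>z. w(Suc k + n := (y, u), Suc (Suc k + n) := (z, undefined))) (kernel M y u))"
  have FF': "F (g w) = map_pmf g (F' w)" for w
    unfolding F_def F'_def g_def
    by (simp add: Let_def state_fun_upd control_fun_upd pmf.map_comp o_def fun_upd_twist)
  have "steps_law M k \<pi> x (Suc (Suc n)) = bind_pmf (steps_law M k \<pi> x (Suc n)) F"
    unfolding F_def by (simp only: steps_law.simps(2))
  also have "\<dots> = bind_pmf (kernel M x (\<pi> k ([], x)))
      (\<lambda>y. bind_pmf (steps_law M (Suc k) (after [p x] \<pi>) y n) (\<lambda>w. map_pmf g (F' w)))"
    unfolding Suc.IH by (simp add: bind_assoc_pmf bind_map_pmf FF' flip: g_def)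
  also have "\<dots> = bind_pmf (kernel M x (\<pi> k ([], x)))
      (\<lambda>y. map_pmf g (steps_law M (Suc k) (after [p x] \<pi>) y (Suc n)))"
    by (simp add: map_bind_pmf F'_def)
  finally show ?case unfolding g_def .
qed

lemma law_horizon: "law M (horizon M) \<pi> x = return_pmf ((\<lambda>_. undefined)(horizon M := (x, undefined)))"
  by (simp add: law_def)

lemma law_first_step:
  fixes \<pi> :: "('s, 'u) policy" and x :: 's
  assumes "k < horizon M"
  shows "law M k \<pi> x = bind_pmf (kernel M x (\<pi> k ([], x)))
      (\<lambda>y. map_pmf (\<lambda>w. w(k := (x, \<pi> k ([], x)))) (law M (Suc k) (after [(x, \<pi> k ([], x))] \<pi>) y))"
proof -
  have "horizon M - k = Suc (horizon M - Suc k)" using assms by simp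
  then show ?thesis unfolding law_def by (simp only: steps_law_Suc_first)
qed

lemma finite_set_law:
  fixes M :: "('s::finite, 'u) problem"
  assumes "k \<le> horizon M"
  shows "finite (set_pmf (law M k \<pi> x))"
  using assms
proof (induction arbitrary: \<pi> x rule: inc_induct)
  case base
  then show ?case by (simp add: law_horizon)
next
  case (step k)
  then show ?case by (simp add: law_first_step)
qed

text \<open>On the support the recorded control is a function of the history, so
  \<open>\<omega> j\<close> is determined by the history up to time \<open>j\<close> although
  \<open>filtration j\<close> does not see the control at that time.\<close>

lemma law_support:
  assumes "k \<le> horizon M" and "\<omega> \<in> set_pmf (law M k \<pi> x)"
  shows "state k \<omega> = x \<and> (\<forall>j \<in> {k..<horizon M}. snd (\<omega> j) = control \<pi> k j \<omega> \<and>
     state (Suc j) \<omega> \<in> set_pmf (kernel M (state j \<omega>) (control \<pi> k j \<omega>)))"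
  using assms
proof (induction arbitrary: \<pi> x \<omega> rule: inc_induct)
  case base
  then show ?case by (simp add: law_horizon state_def)
next
  case (step k)
  let ?u = "\<pi> k ([], x)"
  let ?p = "(x, ?u)"
  from step.prems step.hyps obtain y w where y: "y \<in> set_pmf (kernel M x ?u)"
    and w: "w \<in> set_pmf (law M (Suc k) (after [?p] \<pi>) y)" and \<omega>: "\<omega> = w(k := ?p)"
    by (auto simp: law_first_step)
  note IH = step.IH[OF w]
  have "snd (\<omega> j) = control \<pi> k j \<omega> \<and>
     state (Suc j) \<omega> \<in> set_pmf (kernel M (state j \<omega>) (control \<pi> k j \<omega>))"
    if j: "j \<in> {k..<horizon M}" for j
  proof (cases "j = k")
    case True
    then show ?thesis using IH y by (simp add: \<omega> state_fun_upd control_initial)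
  next
    case False
    then have "j \<in> {Suc k..<horizon M}" using j by auto
    then show ?thesis using IH by (auto simp: \<omega> state_fun_upd control_fun_upd)
  qed
  moreover have "state k \<omega> = x" by (simp add: \<omega> state_def)
  ultimately show ?case by blast
qed

section \<open>Independence from unreachable histories\<close>

text \<open>Policies are total functions, and those obtained below by gluing or from augmented
  policies match only on histories of the right length, started in \<open>x\<close> and within the
  horizon. Law, cost and risk see nothing else.\<close>

definition agree_from ::
  "('s, 'u) problem \<Rightarrow> nat \<Rightarrow> 's \<Rightarrow> ('s, 'u) policy \<Rightarrow> ('s, 'u) policy \<Rightarrow> bool" where
  "agree_from M k x \<pi> \<pi>' \<longleftrightarrow> (\<forall>j \<in> {k..<horizon M}. \<forall>h. length (fst h) = j - k \<longrightarrow>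
     start h = x \<longrightarrow> \<pi> j h = \<pi>' j h)"

lemma agree_from_initial:
  "agree_from M k x \<pi> \<pi>' \<Longrightarrow> k < horizon M \<Longrightarrow> \<pi> k ([], x) = \<pi>' k ([], x)"
  by (auto simp: agree_from_def start_def)

text \<open>The state \<open>y\<close> is arbitrary, since the prefix \<open>(x, u)\<close> makes
  every extended history start in \<open>x\<close>.\<close>

lemma agree_from_after:
  assumes "agree_from M k x \<pi> \<pi>'"
  shows "agree_from M (Suc k) y (after [(x, u)] \<pi>) (after [(x, u)] \<pi>')"
  using assms unfolding agree_from_def after_def
  by (auto simp: start_def)

lemma agree_from_control:
  assumes "agree_from M k x \<pi> \<pi>'" and "state k \<omega> = x" and "j \<in> {k..<horizon M}"
  shows "control \<pi> k j \<omega> = control \<pi>' k j \<omega>"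
proof -
  have "start (hist k j \<omega>) = x"
    using assms by (cases "j = k") (auto simp: start_def hist_def upt_conv_Cons state_def)
  then show ?thesis
    using assms by (auto simp: agree_from_def control_def hist_def)
qed

lemma law_cong:
  assumes "k \<le> horizon M" and "agree_from M k x \<pi> \<pi>'"
  shows "law M k \<pi> x = law M k \<pi>' x"
  using assms
proof (induction arbitrary: \<pi> \<pi>' x rule: inc_induct)
  case base
  then show ?case by (simp add: law_horizon)
next
  case (step k)
  have "\<pi> k ([], x) = \<pi>' k ([], x)"
    using step by (intro agree_from_initial)
  moreover have "law M (Suc k) (after [(x, u)] \<pi>) y = law M (Suc k) (after [(x, u)] \<pi>') y" for u y
    using agree_from_after[OF step.prems] by (rule step.IH)
  ultimately show ?case using step.hyps by (simp add: law_first_step)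
qed

section \<open>Backward recursion for the expected cost\<close>

lemma J_horizon: "J M (horizon M) \<pi> x = 0"
  by (simp add: J_def)

lemma J_first_step:
  fixes M :: "('s::finite, 'u) problem"
  assumes k: "k < horizon M" and u: "u = \<pi> k ([], x)"
  shows "J M k \<pi> x = cost M x u +
    (\<Sum>y\<in>UNIV. pmf (kernel M x u) y * J M (Suc k) (after [(x, u)] \<pi>) y)"
proof -
  let ?f = "\<lambda>\<omega>. \<Sum>j = k..<horizon M. cost M (state j \<omega>) (control \<pi> k j \<omega>)"
  let ?g = "\<lambda>\<omega>. \<Sum>j = Suc k..<horizon M. cost M (state j \<omega>) (control (after [(x, u)] \<pi>) (Suc k) j \<omega>)"
  let ?L = "\<lambda>y. law M (Suc k) (after [(x, u)] \<pi>) y"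
  have fin: "finite (set_pmf (?L y))" for y using k by (intro finite_set_law) simp
  have fg: "?f (w(k := (x, u))) = cost M x u + ?g w" for w
    using k by (simp add: sum.atLeast_Suc_lessThan control_initial state_fun_upd control_fun_upd u)
  have "J M k \<pi> x = (\<Sum>y\<in>UNIV. pmf (kernel M x u) y *\<^sub>R
      measure_pmf.expectation (map_pmf (\<lambda>w. w(k := (x, u))) (?L y)) ?f)"
    unfolding J_def law_first_step[OF k] u[symmetric]
    by (rule pmf_expectation_bind) (auto simp: fin)
  also have "\<dots> = (\<Sum>y\<in>UNIV. pmf (kernel M x u) y * (cost M x u + J M (Suc k) (after [(x, u)] \<pi>) y))"
    by (simp add: fg J_def integrable_measure_pmf_finite[OF fin])
  also have "\<dots> = cost M x u * (\<Sum>y\<in>UNIV. pmf (kernel M x u) y) +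
    (\<Sum>y\<in>UNIV. pmf (kernel M x u) y * J M (Suc k) (after [(x, u)] \<pi>) y)"
    by (simp add: algebra_simps sum.distrib sum_distrib_left)
  also have "(\<Sum>y\<in>UNIV. pmf (kernel M x u) y) = 1"
    by (rule sum_pmf_eq_1) auto
  finally show ?thesis by simp
qed

lemma J_cong:
  fixes M :: "('s::finite, 'u) problem"
  assumes "k \<le> horizon M" and "agree_from M k x \<pi> \<pi>'"
  shows "J M k \<pi> x = J M k \<pi>' x"
proof -
  have "AE \<omega> in measure_pmf (law M k \<pi> x).
      (\<Sum>j = k..<horizon M. cost M (state j \<omega>) (control \<pi> k j \<omega>)) =
      (\<Sum>j = k..<horizon M. cost M (state j \<omega>) (control \<pi>' k j \<omega>))"
    using agree_from_control[OF assms(2)] law_support[OF assms(1)]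
    by (auto simp: AE_measure_pmf_iff intro!: sum.cong)
  then show ?thesis
    unfolding J_def law_cong[OF assms, symmetric] by (intro integral_cong_AE) auto
qed

section \<open>One-step risk of a function of the history\<close>

text \<open>On a finite support every function is bounded and integrable, so membership reduces to
  measurability for every \<open>p\<close>.\<close>

lemma Lp_space_finite_support:
  assumes "finite (set_pmf P)"
  shows "Lp_space p (measure_pmf P) F = borel_measurable F"
proof -
  have "\<exists>C. \<forall>\<omega> \<in> set_pmf P. \<bar>Z \<omega> :: real\<bar> \<le> C" for Z
    using finite_imp_bounded[of "Z ` set_pmf P"] assms by (auto simp: bounded_iff)
  then show ?thesis
    by (auto simp: Lp_space_def AE_measure_pmf_iff integrable_measure_pmf_finite[OF assms])
qed

text \<open>Such a function factors through \<open>hist 0 j\<close>, which maps measurably into a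
  discrete space; the factor \<open>g\<close> evaluates \<open>Z\<close> at a chosen trajectory with
  the given history.\<close>

lemma borel_measurable_filtration:
  assumes "\<And>\<omega> \<omega>'. (\<And>i. i < j \<Longrightarrow> \<omega> i = \<omega>' i) \<Longrightarrow> state j \<omega> = state j \<omega>' \<Longrightarrow> Z \<omega> = Z \<omega>'"
  shows "Z \<in> borel_measurable (filtration j)"
proof -
  define g where "g h = Z (SOME \<omega>. hist 0 j \<omega> = h)" for h
  have "Z \<omega> = g (hist 0 j \<omega>)" for \<omega>
  proof -
    have "hist 0 j (SOME \<omega>'. hist 0 j \<omega>' = hist 0 j \<omega>) = hist 0 j \<omega>"
      by (rule someI[of _ \<omega>]) simp
    then show ?thesis unfolding g_def
      by (intro assms) (auto simp: hist_def)
  qed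
  then have "Z = (\<lambda>\<omega>. g (hist 0 j \<omega>))" by auto
  moreover have "hist 0 j \<in> filtration j \<rightarrow>\<^sub>M count_space UNIV"
    unfolding filtration_def by (rule measurable_vimage_algebra1) simp
  ultimately show ?thesis by (auto intro: measurable_compose)
qed

lemma control_measurable:
  assumes "k \<le> j"
  shows "(\<lambda>\<omega>. f (state j \<omega>) (control \<pi> k j \<omega>) :: real) \<in> borel_measurable (filtration j)"
  using assms by (intro borel_measurable_filtration arg_cong2[where f = f])
    (auto simp: control_def hist_def intro!: arg_cong[where f = "\<pi> j"])

text \<open>One \<open>\<sigma>\<close> serves all trajectory laws, start times and policies; this
  makes risks under different laws comparable. The Markov property is stated at each point of the
  support, which for a pmf is the almost sure statement.\<close>

locale markov_risk_mdp =
  fixes M :: "('s::finite, 'u::finite) problem"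
    and \<sigma> :: "nat \<Rightarrow> ('s \<Rightarrow> real) \<Rightarrow> 's \<Rightarrow> 's pmf \<Rightarrow> real"
  assumes adm_nonempty: "adm M x \<noteq> {}"
    and coherent_\<sigma>: "coherent_functional (\<lambda>f. \<sigma> j f x q)"
    and coherent_risk: "\<lbrakk>k \<le> j; j < horizon M; \<pi> \<in> policies M k\<rbrakk> \<Longrightarrow>
      coherent_one_step (exponent M) (measure_pmf (law M k \<pi> x)) (filtration j) (filtration (Suc j))
        (risk M (law M k \<pi> x) j)"
    and risk_Markov: "\<lbrakk>k \<le> j; j < horizon M; \<pi> \<in> policies M k; \<omega> \<in> set_pmf (law M k \<pi> x)\<rbrakk> \<Longrightarrow>
      risk M (law M k \<pi> x) j (\<lambda>\<omega>. f (state (Suc j) \<omega>)) \<omega> =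
      \<sigma> j f (state j \<omega>) (kernel M (state j \<omega>) (control \<pi> k j \<omega>))"
begin

lemma \<sigma>_mono: "(\<And>y. f y \<le> g y) \<Longrightarrow> \<sigma> j f x q \<le> \<sigma> j g x q"
  using coherent_\<sigma>[of j x q] by (simp add: coherent_functional_def)

lemma \<sigma>_add: "\<sigma> j (\<lambda>y. a + f y) x q = a + \<sigma> j f x q"
  using coherent_\<sigma>[of j x q] by (simp add: coherent_functional_def)

text \<open>Locality: if \<open>Z = W\<close> on an event \<open>A\<close> of \<open>filtration j\<close>, then \<open>Z \<le> C * indicator (- A) + W\<close> for
  some constant \<open>C\<close>, so monotonicity and translation invariance give \<open>\<rho>\<^sub>j Z \<le> \<rho>\<^sub>j W\<close> on \<open>A\<close>. Taking for \<open>A\<close>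
  the atom of \<open>\<omega>\<close> reduces the risk of an arbitrary \<open>Z\<close> to that of a function of the next state.\<close>

lemma risk_eq_\<sigma>:
  assumes k: "k \<le> j" "j < horizon M" and \<pi>: "\<pi> \<in> policies M k"
    and \<omega>: "\<omega> \<in> set_pmf (law M k \<pi> x)"
    and Z: "Z \<in> borel_measurable (filtration (Suc j))"
    and Zf: "\<And>\<omega>'. \<omega>' \<in> set_pmf (law M k \<pi> x) \<Longrightarrow> (\<And>i. i \<le> j \<Longrightarrow> \<omega>' i = \<omega> i) \<Longrightarrow>
      Z \<omega>' = f (state (Suc j) \<omega>')"
  shows "risk M (law M k \<pi> x) j Z \<omega> = \<sigma> j f (state j \<omega>) (kernel M (state j \<omega>) (control \<pi> k j \<omega>))"
proof -
  let ?P = "law M k \<pi> x" and ?F = "filtration j" and ?G = "filtration (Suc j)"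
  let ?\<rho> = "risk M ?P j"
  let ?W = "\<lambda>\<omega>. f (state (Suc j) \<omega>)"
  have kN: "k \<le> horizon M" using k by simp
  have fin: "finite (set_pmf ?P)" by (rule finite_set_law[OF kN])
  note Lp = Lp_space_finite_support[OF fin]
  have mono: "?\<rho> Y \<omega> \<le> ?\<rho> Y' \<omega>"
    if "Y \<in> borel_measurable ?G" "Y' \<in> borel_measurable ?G" "\<forall>\<omega>\<in>set_pmf ?P. Y \<omega> \<le> Y' \<omega>" for Y Y'
    using coherent_risk[OF k \<pi>, of x] that \<omega>
    by (auto simp: coherent_one_step_def Lp AE_measure_pmf_iff)
  have trans: "?\<rho> (\<lambda>\<omega>. B \<omega> + Y \<omega>) \<omega> = B \<omega> + ?\<rho> Y \<omega>"
    if "B \<in> borel_measurable ?F" "Y \<in> borel_measurable ?G" for B Y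
    using coherent_risk[OF k \<pi>, of x] that \<omega>
    by (auto simp: coherent_one_step_def Lp AE_measure_pmf_iff)
  define A where "A = {\<omega>'. (\<forall>i<j. \<omega>' i = \<omega> i) \<and> state j \<omega>' = state j \<omega>}"
  have W: "?W \<in> borel_measurable ?G"
    by (rule borel_measurable_filtration) simp
  \<comment> \<open>On the support, the atom \<open>A\<close> also fixes the control at time
    \<open>j\<close>, so \<open>\<omega>'\<close> and \<open>\<omega>\<close> agree up to and
    including \<open>j\<close>, as \<open>Zf\<close> demands.\<close>
  have ZW: "Z \<omega>' = ?W \<omega>'" if "\<omega>' \<in> set_pmf ?P" "\<omega>' \<in> A" for \<omega>'
  proof (rule Zf[OF that(1)])
    fix i assume i: "i \<le> j"
    have "snd (\<omega>' j) = control \<pi> k j \<omega>'" "snd (\<omega> j) = control \<pi> k j \<omega>"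
      using law_support[OF kN that(1)] law_support[OF kN \<omega>] k by auto
    moreover have "control \<pi> k j \<omega>' = control \<pi> k j \<omega>"
      using that(2) by (auto simp: control_def hist_def A_def intro!: arg_cong[where f = "\<pi> j"])
    ultimately have "\<omega>' j = \<omega> j"
      using that(2) by (auto simp: A_def state_def intro: prod_eqI)
    then show "\<omega>' i = \<omega> i" using i that(2) by (cases "i = j") (auto simp: A_def)
  qed
  obtain C where C: "\<And>\<omega>'. \<omega>' \<in> set_pmf ?P \<Longrightarrow> \<bar>Z \<omega>' - ?W \<omega>'\<bar> \<le> C"
    using finite_imp_bounded[OF finite_imageI[OF fin], of "\<lambda>\<omega>'. Z \<omega>' - ?W \<omega>'"]
    by (auto simp: bounded_iff)
  define B where "B \<omega>' = (if \<omega>' \<in> A then 0 else C)" for \<omega>'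
  have BF: "B \<in> borel_measurable ?F"
    by (rule borel_measurable_filtration) (auto simp: B_def A_def)
  have BG: "B \<in> borel_measurable ?G"
    by (rule borel_measurable_filtration) (auto simp: B_def A_def state_def)
  have le: "\<bar>Z \<omega>' - ?W \<omega>'\<bar> \<le> B \<omega>'" if "\<omega>' \<in> set_pmf ?P" for \<omega>'
    using C[OF that] ZW[OF that] by (auto simp: B_def)
  have "B \<omega> = 0" by (simp add: B_def A_def)
  have "?\<rho> Z \<omega> \<le> ?\<rho> (\<lambda>\<omega>. B \<omega> + ?W \<omega>) \<omega>"
    using le Z W BG by (intro mono borel_measurable_add) (auto simp: abs_le_iff algebra_simps)
  also have "\<dots> = ?\<rho> ?W \<omega>" using trans[OF BF W] \<open>B \<omega> = 0\<close> by simp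
  finally have 1: "?\<rho> Z \<omega> \<le> ?\<rho> ?W \<omega>" .
  have "?\<rho> ?W \<omega> \<le> ?\<rho> (\<lambda>\<omega>. B \<omega> + Z \<omega>) \<omega>"
    using le Z W BG by (intro mono borel_measurable_add) (auto simp: abs_le_iff algebra_simps)
  also have "\<dots> = ?\<rho> Z \<omega>" using trans[OF BF Z] \<open>B \<omega> = 0\<close> by simp
  finally have "?\<rho> Z \<omega> = ?\<rho> ?W \<omega>" using 1 by simp
  then show ?thesis using risk_Markov[OF k \<pi> \<omega>] by simp
qed

lemma risk_measurable:
  assumes "k \<le> j" "j < horizon M" "\<pi> \<in> policies M k" "Z \<in> borel_measurable (filtration (Suc j))"
  shows "risk M (law M k \<pi> x) j Z \<in> borel_measurable (filtration j)"
proof -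
  have "finite (set_pmf (law M k \<pi> x))" using assms by (intro finite_set_law) simp
  from Lp_space_finite_support[OF this] coherent_risk[OF assms(1-3), of x] assms(4)
  show ?thesis by (simp add: coherent_one_step_def)
qed

section \<open>Recursion for the risk-to-go of a policy\<close>

text \<open>The risk with \<open>n\<close> steps to go as a plain number. No trajectory law occurs
  in it, so continuations from different states can be compared directly.\<close>

primrec nested_risk :: "nat \<Rightarrow> nat \<Rightarrow> ('s, 'u) policy \<Rightarrow> 's \<Rightarrow> real" where
  "nested_risk 0 k \<pi> x = 0"
| "nested_risk (Suc n) k \<pi> x = risk_cost M x (\<pi> k ([], x)) +
     \<sigma> k (\<lambda>y. nested_risk n (Suc k) (after [(x, \<pi> k ([], x))] \<pi>) y) x (kernel M x (\<pi> k ([], x)))"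

text \<open>All later times \<open>j\<close> are treated under the one law started at
  \<open>k\<close>, with the past moved into the continuation policy. Measurability and value are
  proved together because \<open>risk_eq_\<sigma>\<close> needs the later risk to be
  measurable.\<close>

lemma dyn_risk_eq_nested_risk:
  assumes \<pi>: "\<pi> \<in> policies M k" and k: "k \<le> j" "j + n = horizon M"
  shows "dyn_risk (risk M (law M k \<pi> x)) (stage_risk_cost M k \<pi>) j n \<in> borel_measurable (filtration j) \<and>
    (\<forall>\<omega> \<in> set_pmf (law M k \<pi> x).
      dyn_risk (risk M (law M k \<pi> x)) (stage_risk_cost M k \<pi>) j n \<omega> =
      nested_risk n j (after (map \<omega> [k..<j]) \<pi>) (state j \<omega>))"
  using k
proof (induction n arbitrary: j)
  case 0
  then have "stage_risk_cost M k \<pi> j = (\<lambda>_. 0)" by (auto simp: stage_risk_cost_def)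
  then show ?case by simp
next
  case (Suc n)
  let ?P = "law M k \<pi> x"
  let ?D = "dyn_risk (risk M ?P) (stage_risk_cost M k \<pi>)"
  have j: "k \<le> j" "j < horizon M" "k \<le> Suc j" "Suc j + n = horizon M" using Suc.prems by auto
  have kN: "k \<le> horizon M" using j by simp
  note IH = Suc.IH[OF j(3,4)]
  have stage: "stage_risk_cost M k \<pi> j = (\<lambda>\<omega>. risk_cost M (state j \<omega>) (control \<pi> k j \<omega>))"
    using j by (auto simp: stage_risk_cost_def)
  have "?D j (Suc n) \<in> borel_measurable (filtration j)"
    unfolding dyn_risk.simps stage
    using IH \<pi> j by (intro borel_measurable_add control_measurable risk_measurable) auto
  moreover have "?D j (Suc n) \<omega> = nested_risk (Suc n) j (after (map \<omega> [k..<j]) \<pi>) (state j \<omega>)"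
    if \<omega>: "\<omega> \<in> set_pmf ?P" for \<omega>
  proof -
    let ?u = "control \<pi> k j \<omega>"
    have "snd (\<omega> j) = ?u" using law_support[OF kN \<omega>] j by auto
    then have \<omega>j: "\<omega> j = (state j \<omega>, ?u)" by (simp add: state_def prod_eq_iff)
    have u: "after (map \<omega> [k..<j]) \<pi> j ([], state j \<omega>) = ?u"
      by (simp add: after_def control_def hist_def)
    \<comment> \<open>Trajectories that agree through time \<open>j\<close> share the continuation
      policy, so along them the later risk is a function of the next state alone.\<close>
    have "risk M ?P j (?D (Suc j) n) \<omega> =
      \<sigma> j (\<lambda>y. nested_risk n (Suc j) (after (map \<omega> [k..<Suc j]) \<pi>) y) (state j \<omega>)
        (kernel M (state j \<omega>) ?u)"
    proof (rule risk_eq_\<sigma>[OF j(1,2) \<pi> \<omega>])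
      fix \<omega>' assume *: "\<omega>' \<in> set_pmf ?P" "\<And>i. i \<le> j \<Longrightarrow> \<omega>' i = \<omega> i"
      then have "map \<omega>' [k..<Suc j] = map \<omega> [k..<Suc j]" by auto
      then show "?D (Suc j) n \<omega>' =
        nested_risk n (Suc j) (after (map \<omega> [k..<Suc j]) \<pi>) (state (Suc j) \<omega>')"
        using IH *(1) by metis
    qed (use IH in auto)
    then show ?thesis using j(1) by (simp add: stage u \<omega>j)
  qed
  ultimately show ?case by blast
qed

text \<open>At time \<open>k\<close> the prefix is empty and the state is \<open>x\<close> on the
  whole support, so the dynamic risk is constant there and the definite description in
  \<open>R\<close> picks that constant.\<close>

lemma R_eq_nested_risk:
  assumes \<pi>: "\<pi> \<in> policies M k" and k: "k \<le> horizon M"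
  shows "R M k \<pi> x = nested_risk (horizon M - k) k \<pi> x"
proof -
  have "\<forall>\<omega> \<in> set_pmf (law M k \<pi> x).
      dyn_risk (risk M (law M k \<pi> x)) (stage_risk_cost M k \<pi>) k (horizon M - k) \<omega> =
      nested_risk (horizon M - k) k \<pi> x"
    using dyn_risk_eq_nested_risk[OF \<pi>, of k "horizon M - k" x] law_support[OF k, of _ \<pi> x] k by auto
  then show ?thesis
    unfolding R_def AE_measure_pmf_iff using set_pmf_not_empty[of "law M k \<pi> x"]
    by (intro the_equality) (auto simp: ex_in_conv[symmetric])
qed

lemma R_horizon: "\<pi> \<in> policies M (horizon M) \<Longrightarrow> R M (horizon M) \<pi> x = 0"
  by (simp add: R_eq_nested_risk)

text \<open>The two sides refer to risk measures under different laws; both reduce to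
  \<open>nested_risk\<close>, where the recursion holds by definition.\<close>

lemma R_first_step:
  assumes \<pi>: "\<pi> \<in> policies M k" and k: "k < horizon M" and u: "u = \<pi> k ([], x)"
  shows "R M k \<pi> x = risk_cost M x u + \<sigma> k (\<lambda>y. R M (Suc k) (after [(x, u)] \<pi>) y) x (kernel M x u)"
proof -
  have "horizon M - k = Suc (horizon M - Suc k)" using k by simp
  then show ?thesis
    using k after_in_policies[OF \<pi>] by (simp add: R_eq_nested_risk \<pi> u)
qed

lemma nested_risk_cong:
  assumes "agree_from M k x \<pi> \<pi>'" "k + n \<le> horizon M"
  shows "nested_risk n k \<pi> x = nested_risk n k \<pi>' x"
  using assms
proof (induction n arbitrary: k x \<pi> \<pi>')
  case (Suc n)
  have "\<pi> k ([], x) = \<pi>' k ([], x)" using Suc.prems by (intro agree_from_initial) auto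
  then show ?case using Suc.prems by (simp add: Suc.IH[OF agree_from_after])
qed simp

lemma R_cong:
  assumes "agree_from M k x \<pi> \<pi>'" "k \<le> horizon M" "\<pi> \<in> policies M k" "\<pi>' \<in> policies M k"
  shows "R M k \<pi> x = R M k \<pi>' x"
  using assms by (simp add: R_eq_nested_risk nested_risk_cong)

section \<open>Attainment of the minima\<close>

lemma policies_nonempty: "policies M k \<noteq> {}"
proof -
  have "(\<lambda>j h. SOME u. u \<in> adm M (snd h)) \<in> policies M k"
    using adm_nonempty by (auto simp: policies_def some_in_eq)
  then show ?thesis by blast
qed

text \<open>The pair is determined by the first control and by one pair for each successor, and both
  range over finite sets by backward induction.\<close>

lemma finite_R_J:
  assumes "k \<le> horizon M"
  shows "finite ((\<lambda>\<pi>. (R M k \<pi> x, J M k \<pi> x)) ` policies M k)"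
  using assms
proof (induction arbitrary: x rule: inc_induct)
  case base
  have "(\<lambda>\<pi>. (R M (horizon M) \<pi> x, J M (horizon M) \<pi> x)) ` policies M (horizon M) \<subseteq> {(0, 0)}"
    by (auto simp: R_horizon J_horizon)
  then show ?case by (rule finite_subset) simp
next
  case (step k)
  let ?A = "\<lambda>y. (\<lambda>\<pi>. (R M (Suc k) \<pi> y, J M (Suc k) \<pi> y)) ` policies M (Suc k)"
  let ?g = "\<lambda>(u, f). (risk_cost M x u + \<sigma> k (fst \<circ> f) x (kernel M x u),
     cost M x u + (\<Sum>y\<in>UNIV. pmf (kernel M x u) y * snd (f y)))"
  \<comment> \<open>A policy has one continuation for all \<open>y\<close>, while the product allows
    independent choices; a finite superset is enough.\<close>
  have "(R M k \<pi> x, J M k \<pi> x) \<in> ?g ` (UNIV \<times> PiE UNIV ?A)" if \<pi>: "\<pi> \<in> policies M k" for \<pi>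
  proof -
    let ?u = "\<pi> k ([], x)"
    let ?\<pi>' = "after [(x, ?u)] \<pi>"
    let ?f = "\<lambda>y. (R M (Suc k) ?\<pi>' y, J M (Suc k) ?\<pi>' y)"
    have "(?u, ?f) \<in> UNIV \<times> PiE UNIV ?A" using after_in_policies[OF \<pi>] by auto
    moreover have "(R M k \<pi> x, J M k \<pi> x) = ?g (?u, ?f)"
      using R_first_step[OF \<pi> step.hyps(2) refl] J_first_step[OF step.hyps(2) refl] by (simp add: o_def)
    ultimately show ?thesis by blast
  qed
  moreover have "finite (?g ` (UNIV \<times> PiE UNIV ?A))"
    by (intro finite_imageI finite_cartesian_product finite_PiE step.IH) auto
  ultimately show ?case by (meson finite_subset image_subsetI)
qed

text \<open>Attainment of the minimal risk turns the half-line into existence of a policy. The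
  terminal case fits because the risk at the horizon is 0.\<close>

lemma \<Phi>_iff:
  assumes k: "k \<le> horizon M"
  shows "r \<in> \<Phi> M k x \<longleftrightarrow> (\<exists>\<pi> \<in> policies M k. R M k \<pi> x \<le> r)"
proof -
  let ?A = "(\<lambda>\<pi>. R M k \<pi> x) ` policies M k"
  have "?A = fst ` ((\<lambda>\<pi>. (R M k \<pi> x, J M k \<pi> x)) ` policies M k)"
    by (auto simp: image_image)
  also have "finite \<dots>" by (intro finite_imageI finite_R_J[OF k])
  finally have fin: "finite ?A" .
  have ne: "?A \<noteq> {}" using policies_nonempty by simp
  have min: "R_min M k x = Min ?A"
    using cInf_eq_Min[OF fin ne] by (simp add: R_min_def)
  show ?thesis
  proof (cases "k < horizon M")
    case True
    then show ?thesis using Min_le_iff[OF fin ne, of r] by (simp add: \<Phi>_def min)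
  next
    case False
    then have "k = horizon M" using k by simp
    then show ?thesis using policies_nonempty by (auto simp: \<Phi>_def R_horizon)
  qed
qed

section \<open>The value function of OPT as a minimum of reals\<close>

definition min_cost :: "nat \<Rightarrow> 's \<Rightarrow> real \<Rightarrow> real" where
  "min_cost k x r = Min ((\<lambda>\<pi>. J M k \<pi> x) ` {\<pi> \<in> policies M k. R M k \<pi> x \<le> r})"

lemma finite_feasible_costs:
  assumes "k \<le> horizon M"
  shows "finite ((\<lambda>\<pi>. J M k \<pi> x) ` {\<pi> \<in> policies M k. R M k \<pi> x \<le> r})"
proof -
  have "(\<lambda>\<pi>. J M k \<pi> x) ` {\<pi> \<in> policies M k. R M k \<pi> x \<le> r} \<subseteq>
    snd ` ((\<lambda>\<pi>. (R M k \<pi> x, J M k \<pi> x)) ` policies M k)"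
    by (auto simp: image_image)
  then show ?thesis using finite_R_J[OF assms, of x] by (meson finite_imageI finite_subset)
qed

lemma min_cost_le:
  assumes "k \<le> horizon M" "\<pi> \<in> policies M k" "R M k \<pi> x \<le> r"
  shows "min_cost k x r \<le> J M k \<pi> x"
  unfolding min_cost_def using assms by (intro Min_le finite_feasible_costs) auto

lemma min_cost_attained:
  assumes "k \<le> horizon M" "r \<in> \<Phi> M k x"
  obtains \<pi> where "\<pi> \<in> policies M k" "R M k \<pi> x \<le> r" "J M k \<pi> x = min_cost k x r"
proof -
  have "min_cost k x r \<in> (\<lambda>\<pi>. J M k \<pi> x) ` {\<pi> \<in> policies M k. R M k \<pi> x \<le> r}"
    unfolding min_cost_def
    using \<Phi>_iff[OF assms(1)] assms(2) by (intro Min_in finite_feasible_costs[OF assms(1)]) auto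
  then show ?thesis using that by auto
qed

lemma V_eq_min_cost:
  assumes "k < horizon M" "r \<in> \<Phi> M k x"
  shows "V M k x r = ereal (min_cost k x r)"
proof -
  have k: "k \<le> horizon M" using assms by simp
  obtain \<pi> where \<pi>: "\<pi> \<in> policies M k" "R M k \<pi> x \<le> r" "J M k \<pi> x = min_cost k x r"
    using min_cost_attained[OF k assms(2)] .
  have "(INF \<pi> \<in> {\<pi> \<in> policies M k. R M k \<pi> x \<le> r}. ereal (J M k \<pi> x)) = ereal (min_cost k x r)"
  proof (rule antisym)
    show "(INF \<pi> \<in> {\<pi> \<in> policies M k. R M k \<pi> x \<le> r}. ereal (J M k \<pi> x)) \<le> ereal (min_cost k x r)"
      using \<pi> by (intro INF_lower2[of \<pi>]) auto
  next
    show "ereal (min_cost k x r) \<le> (INF \<pi> \<in> {\<pi> \<in> policies M k. R M k \<pi> x \<le> r}. ereal (J M k \<pi> x))"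
      using min_cost_le[OF k] by (intro INF_greatest) auto
  qed
  then show ?thesis using assms by (simp add: V_def)
qed

text \<open>History dependence lets the continuation be selected by the state reached at time
  \<open>k + 1\<close>, so separately chosen continuations fit into one policy.\<close>

lemma combine_policies:
  assumes k: "k < horizon M" and u: "u \<in> adm M x" and p: "\<And>y. p y \<in> policies M (Suc k)"
  obtains \<pi> where "\<pi> \<in> policies M k"
    "R M k \<pi> x = risk_cost M x u + \<sigma> k (\<lambda>y. R M (Suc k) (p y) y) x (kernel M x u)"
    "J M k \<pi> x = cost M x u + (\<Sum>y\<in>UNIV. pmf (kernel M x u) y * J M (Suc k) (p y) y)"
proof -
  \<comment> \<open>The first recorded step is stripped before \<open>p\<close> is consulted, and
    \<open>start\<close> reads the successor off the rest. An arbitrary admissible control fills the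
    remaining case of an empty record.\<close>
  define \<pi> where "\<pi> j h = (case fst h of
      [] \<Rightarrow> if snd h = x then u else (SOME u. u \<in> adm M (snd h))
    | _ # t \<Rightarrow> p (start (t, snd h)) j (t, snd h))" for j :: nat and h :: "('s, 'u) history"
  have \<pi>: "\<pi> \<in> policies M k"
    unfolding policies_def
  proof (intro CollectI allI impI)
    fix j and h :: "('s, 'u) history"
    assume j: "k \<le> j" "length (fst h) = j - k"
    show "\<pi> j h \<in> adm M (snd h)"
    proof (cases "fst h")
      case Nil
      then show ?thesis using u adm_nonempty by (auto simp: \<pi>_def some_in_eq)
    next
      case (Cons a t)
      then have "Suc k \<le> j" "length (fst (t, snd h)) = j - Suc k" using j by auto
      then show ?thesis
        using p[of "start (t, snd h)"] Cons by (fastforce simp: \<pi>_def policies_def)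
    qed
  qed
  have \<pi>u: "u = \<pi> k ([], x)" by (simp add: \<pi>_def)
  have ag: "agree_from M (Suc k) y (after [(x, u)] \<pi>) (p y)" for y
    by (auto simp: agree_from_def after_def \<pi>_def)
  have "R M (Suc k) (after [(x, u)] \<pi>) y = R M (Suc k) (p y) y"
    "J M (Suc k) (after [(x, u)] \<pi>) y = J M (Suc k) (p y) y" for y
    using R_cong[OF ag _ after_in_policies[OF \<pi>] p] J_cong[OF _ ag] k by auto
  then show ?thesis
    using that[OF \<pi>] R_first_step[OF \<pi> k \<pi>u] J_first_step[where \<pi> = \<pi> and x = x, OF k \<pi>u] by simp
qed

end

section \<open>Augmented policies\<close>

lemma aug_policies_mono: "k \<le> k' \<Longrightarrow> aug_policies M k \<subseteq> aug_policies M k'"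
  by (auto simp: aug_policies_def)

lemma updates_mono: "k \<le> k' \<Longrightarrow> updates M k \<subseteq> updates M k'"
  by (auto simp: updates_def)

text \<open>\<open>risk_to_go\<close> recurses from the first pair of states, while the threshold
  process evolves at the last pair.\<close>

lemma risk_to_go_snoc:
  "risk_to_go upd k r (xs @ [x, y]) =
    (let r' = risk_to_go upd k r (xs @ [x]) in upd (Suc (k + length xs)) x r' y + r')"
proof (induction xs arbitrary: k r)
  case (Cons z zs)
  obtain z' t where t: "zs @ [x] = z' # t" by (cases zs) auto
  then have "zs @ [x, y] = z' # t @ [y]" by (metis append_Cons append_assoc append_Nil)
  then have "risk_to_go upd k r (z # zs @ [x, y]) =
    risk_to_go upd (Suc k) (upd (Suc k) z r z' + r) (zs @ [x, y])"
    by (simp only: risk_to_go.simps)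
  then show ?case using Cons[of "Suc k" "upd (Suc k) z r z' + r"] t by simp
qed simp

lemma risk_to_go_in_\<Phi>:
  assumes "upd \<in> updates M k" "xs \<noteq> []" "r \<in> \<Phi> M k (hd xs)" "k + length xs \<le> Suc (horizon M)"
  shows "risk_to_go upd k r xs \<in> \<Phi> M (k + length xs - 1) (last xs)"
  using assms
proof (induction upd k r xs rule: risk_to_go.induct)
  case (1 upd k r x y xs)
  have "upd (Suc k) x r y + r \<in> \<Phi> M (Suc k) y"
    using 1(2,4,5) by (auto simp: updates_def)
  moreover have "upd \<in> updates M (Suc k)" using 1(2) updates_mono[of k "Suc k" M] by auto
  ultimately show ?case using 1(1) 1(5) by simp
qed auto

lemma threshold_initial [simp]: "threshold upd k r k \<omega> = r"
  by (simp add: threshold_def)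

lemma threshold_Suc:
  assumes "k \<le> j"
  shows "threshold upd k r (Suc j) \<omega> =
    upd (Suc j) (state j \<omega>) (threshold upd k r j \<omega>) (state (Suc j) \<omega>) + threshold upd k r j \<omega>"
  using assms risk_to_go_snoc[of upd k r "map (\<lambda>i. state i \<omega>) [k..<j]" "state j \<omega>" "state (Suc j) \<omega>"]
  by (simp add: threshold_def Let_def)

lemma threshold_in_\<Phi>:
  assumes "upd \<in> updates M k" "r \<in> \<Phi> M k (state k \<omega>)" "k \<le> j" "j \<le> horizon M"
  shows "threshold upd k r j \<omega> \<in> \<Phi> M j (state j \<omega>)"
proof -
  let ?xs = "map (\<lambda>i. state i \<omega>) [k..<Suc j]"
  have "hd ?xs = state k \<omega>" using assms(3) by (subst upt_conv_Cons) auto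
  moreover have "?xs \<noteq> []" using assms(3) by simp
  ultimately have "risk_to_go upd k r ?xs \<in> \<Phi> M (k + length ?xs - 1) (last ?xs)"
    using assms by (intro risk_to_go_in_\<Phi>) simp_all
  then show ?thesis using assms(3) by (simp add: threshold_def Suc_diff_le)
qed

lemma threshold_fun_upd:
  assumes "Suc k \<le> j"
  shows "threshold upd k r j (w(k := (x, u))) =
    threshold upd (Suc k) (upd (Suc k) x r (state (Suc k) w) + r) j w"
proof -
  have "map (\<lambda>i. state i (w(k := (x, u)))) [k..<Suc j] =
    x # state (Suc k) w # map (\<lambda>i. state i w) [Suc (Suc k)..<Suc j]"
    using assms by (simp add: upt_conv_Cons state_fun_upd del: upt_Suc)
  moreover have "map (\<lambda>i. state i w) [Suc k..<Suc j] =
    state (Suc k) w # map (\<lambda>i. state i w) [Suc (Suc k)..<Suc j]"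
    using assms by (simp add: upt_conv_Cons del: upt_Suc)
  ultimately show ?thesis unfolding threshold_def by simp
qed

lemma threshold_depends:
  assumes "\<And>i. i < j \<Longrightarrow> \<omega> i = \<omega>' i" "state j \<omega> = state j \<omega>'"
  shows "threshold upd k r j \<omega> = threshold upd k r j \<omega>'"
  unfolding threshold_def using assms
  by (intro arg_cong[where f = "risk_to_go upd k r"]) (auto simp: state_def less_Suc_eq)

lemma control_induced:
  assumes "k \<le> j"
  shows "control (induced \<pi> upd k r) k j \<omega> = \<pi> j (state j \<omega>) (threshold upd k r j \<omega>)"
  using assms by (simp add: control_def induced_def hist_def threshold_def comp_def state_def[abs_def])

lemma induced_initial [simp]: "induced \<pi> upd k r k ([], x) = \<pi> k x r"
  by (simp add: induced_def)

text \<open>The updated threshold summarises the past: on histories from \<open>y\<close>, the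
  continuation is induced by the same families. The first-step recursions for augmented policies
  rest on this.\<close>

lemma agree_from_after_induced:
  fixes M :: "('s, 'u) problem"
  shows "agree_from M (Suc k) y (after [(x, u)] (induced \<pi> upd k r))
    (induced \<pi> upd (Suc k) (upd (Suc k) x r y + r))"
  unfolding agree_from_def
proof (intro ballI allI impI)
  fix j and h :: "('s, 'u) history"
  assume "start h = y"
  then obtain t where "map fst (fst h) @ [snd h] = y # t"
    by (cases "map fst (fst h) @ [snd h]") (auto simp: start_def)
  then show "after [(x, u)] (induced \<pi> upd k r) j h =
    induced \<pi> upd (Suc k) (upd (Suc k) x r y + r) j h"
    by (simp add: after_def induced_def)
qed

lemma J_aug_horizon: "J_aug M (horizon M) x r \<pi> upd = 0"
  by (simp add: J_aug_def J_horizon)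

lemma J_aug_first_step:
  fixes M :: "('s::finite, 'u) problem"
  assumes "k < horizon M"
  shows "J_aug M k x r \<pi> upd = cost M x (\<pi> k x r) + (\<Sum>y\<in>UNIV. pmf (kernel M x (\<pi> k x r)) y *
    J_aug M (Suc k) y (upd (Suc k) x r y + r) \<pi> upd)"
  using assms by (simp add: J_aug_def J_first_step[OF assms refl]
    J_cong[OF _ agree_from_after_induced])

lemma set_aug_law_first_step:
  fixes M :: "('s::finite, 'u) problem"
  assumes "k < horizon M"
  shows "set_pmf (aug_law M k x r \<pi> upd) = (\<Union>y \<in> set_pmf (kernel M x (\<pi> k x r)).
    (\<lambda>w. w(k := (x, \<pi> k x r))) ` set_pmf (aug_law M (Suc k) y (upd (Suc k) x r y + r) \<pi> upd))"
  using assms by (simp add: aug_law_def law_first_step law_cong[OF _ agree_from_after_induced])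

context markov_risk_mdp
begin

text \<open>\<open>induced\<close> may be inadmissible at thresholds outside \<open>\<Phi>\<close>
  or beyond the horizon. The updates keep thresholds inside \<open>\<Phi>\<close> on the relevant
  histories, so repairing the other values is harmless.\<close>

lemma induced_agrees_with_policy:
  assumes "\<pi> \<in> aug_policies M k" "upd \<in> updates M k" "r \<in> \<Phi> M k x"
  obtains \<pi>' where "\<pi>' \<in> policies M k" "agree_from M k x (induced \<pi> upd k r) \<pi>'"
proof -
  define \<pi>' where "\<pi>' j h = (if induced \<pi> upd k r j h \<in> adm M (snd h) then induced \<pi> upd k r j h
    else SOME u. u \<in> adm M (snd h))" for j and h :: "('s, 'u) history"
  have "\<pi>' \<in> policies M k"
    using adm_nonempty by (auto simp: policies_def \<pi>'_def some_in_eq)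
  moreover have "induced \<pi> upd k r j h \<in> adm M (snd h)"
    if "j \<in> {k..<horizon M}" "length (fst h) = j - k" "start h = x" for j h
  proof -
    have "risk_to_go upd k r (map fst (fst h) @ [snd h]) \<in>
      \<Phi> M (k + length (map fst (fst h) @ [snd h]) - 1) (last (map fst (fst h) @ [snd h]))"
      using that assms by (intro risk_to_go_in_\<Phi>) (auto simp: start_def)
    then have "risk_to_go upd k r (map fst (fst h) @ [snd h]) \<in> \<Phi> M j (snd h)"
      using that by simp
    then show ?thesis using assms(1) that by (auto simp: induced_def aug_policies_def)
  qed
  then have "agree_from M k x (induced \<pi> upd k r) \<pi>'"
    by (auto simp: agree_from_def \<pi>'_def)
  ultimately show ?thesis using that by blast
qed

section \<open>Feasibility expressed through \<sigma>\<close>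

definition stage_constraint ::
  "('s, 'u) aug_policy \<Rightarrow> 's update \<Rightarrow> nat \<Rightarrow> 's \<Rightarrow> real \<Rightarrow> bool" where
  "stage_constraint \<pi> upd j x r \<longleftrightarrow>
    risk_cost M x (\<pi> j x r) + \<sigma> j (\<lambda>y. upd (Suc j) x r y + r) x (kernel M x (\<pi> j x r)) = r"

definition constraints ::
  "('s, 'u) aug_policy \<Rightarrow> 's update \<Rightarrow> nat \<Rightarrow> 's \<Rightarrow> real \<Rightarrow> bool" where
  "constraints \<pi> upd k x r \<longleftrightarrow> (\<forall>\<omega> \<in> set_pmf (aug_law M k x r \<pi> upd).
    (\<forall>j \<in> {k..<horizon M}. stage_constraint \<pi> upd j (state j \<omega>) (threshold upd k r j \<omega>)) \<and>
    0 \<le> threshold upd k r (horizon M) \<omega>)"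

lemma constraints_horizon: "constraints \<pi> upd (horizon M) x r \<longleftrightarrow> 0 \<le> r"
  by (simp add: constraints_def aug_law_def law_horizon)

lemma constraints_first_step:
  assumes k: "k < horizon M"
  shows "constraints \<pi> upd k x r \<longleftrightarrow> stage_constraint \<pi> upd k x r \<and>
    (\<forall>y \<in> set_pmf (kernel M x (\<pi> k x r)). constraints \<pi> upd (Suc k) y (upd (Suc k) x r y + r))"
proof -
  let ?u = "\<pi> k x r"
  let ?L = "\<lambda>y. set_pmf (aug_law M (Suc k) y (upd (Suc k) x r y + r) \<pi> upd)"
  let ?C = "\<lambda>k r \<omega>. (\<forall>j \<in> {k..<horizon M}.
      stage_constraint \<pi> upd j (state j \<omega>) (threshold upd k r j \<omega>)) \<and>
      0 \<le> threshold upd k r (horizon M) \<omega>"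
  have C: "?C k r (w(k := (x, ?u))) \<longleftrightarrow>
    stage_constraint \<pi> upd k x r \<and> ?C (Suc k) (upd (Suc k) x r y + r) w"
    if "w \<in> ?L y" for w y
  proof -
    have y: "state (Suc k) w = y" using law_support[of "Suc k" M w] that k by (auto simp: aug_law_def)
    have "{k..<horizon M} = insert k {Suc k..<horizon M}" using k by auto
    then show ?thesis using k by (auto simp: threshold_fun_upd y state_fun_upd)
  qed
  have "constraints \<pi> upd k x r \<longleftrightarrow> (\<forall>y \<in> set_pmf (kernel M x ?u). \<forall>w \<in> ?L y. ?C k r (w(k := (x, ?u))))"
    unfolding constraints_def set_aug_law_first_step[OF k] by blast
  also have "\<dots> \<longleftrightarrow> (\<forall>y \<in> set_pmf (kernel M x ?u). \<forall>w \<in> ?L y.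
      stage_constraint \<pi> upd k x r \<and> ?C (Suc k) (upd (Suc k) x r y + r) w)"
    using C by blast
  also have "\<dots> \<longleftrightarrow> stage_constraint \<pi> upd k x r \<and>
    (\<forall>y \<in> set_pmf (kernel M x ?u). constraints \<pi> upd (Suc k) y (upd (Suc k) x r y + r))"
  proof -
    \<comment> \<open>Nonempty supports allow the stage constraint, which is free of
      \<open>y\<close> and \<open>w\<close>, to leave the quantifiers.\<close>
    have "set_pmf (kernel M x ?u) \<noteq> {}" "?L y \<noteq> {}" for y by (rule set_pmf_not_empty)+
    then show ?thesis unfolding constraints_def by blast
  qed
  finally show ?thesis .
qed

text \<open>Once the induced policy is replaced by an admissible one with the same law,
  \<open>risk_eq_\<sigma>\<close> evaluates each constraint on the support. The stage cost is known
  at time \<open>j\<close>, hence a constant that \<open>\<sigma>_add\<close> pulls out.\<close>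

lemma feasible_iff:
  assumes k: "k \<le> horizon M" and r: "r \<in> \<Phi> M k x"
  shows "feasible M k x r \<pi> upd \<longleftrightarrow>
    \<pi> \<in> aug_policies M k \<and> upd \<in> updates M k \<and> constraints \<pi> upd k x r"
proof (cases "\<pi> \<in> aug_policies M k \<and> upd \<in> updates M k")
  case True
  then obtain \<pi>' where \<pi>': "\<pi>' \<in> policies M k" and ag: "agree_from M k x (induced \<pi> upd k r) \<pi>'"
    using induced_agrees_with_policy r by blast
  let ?rr = "threshold upd k r"
  let ?P = "aug_law M k x r \<pi> upd"
  have P: "?P = law M k \<pi>' x" unfolding aug_law_def by (rule law_cong[OF k ag])
  have "risk M ?P j (\<lambda>\<omega>. ?rr (Suc j) \<omega> + risk_cost M (state j \<omega>) (\<pi> j (state j \<omega>) (?rr j \<omega>))) \<omega> = ?rr j \<omega>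
    \<longleftrightarrow> stage_constraint \<pi> upd j (state j \<omega>) (?rr j \<omega>)"
    if \<omega>: "\<omega> \<in> set_pmf ?P" and j: "k \<le> j" "j < horizon M" for \<omega> j
  proof -
    let ?x = "state j \<omega>" and ?r = "?rr j \<omega>"
    have "state k \<omega> = x" using law_support[OF k] \<omega> by (simp add: P)
    then have u: "control \<pi>' k j \<omega> = \<pi> j ?x ?r"
      using agree_from_control[OF ag _ , of \<omega> j] j control_induced[of k j \<pi> upd r \<omega>] by simp
    have "risk M (law M k \<pi>' x) j
        (\<lambda>\<omega>. ?rr (Suc j) \<omega> + risk_cost M (state j \<omega>) (\<pi> j (state j \<omega>) (?rr j \<omega>))) \<omega> =
      \<sigma> j (\<lambda>y. risk_cost M ?x (\<pi> j ?x ?r) + (upd (Suc j) ?x ?r y + ?r)) ?x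
        (kernel M ?x (control \<pi>' k j \<omega>))"
    proof (rule risk_eq_\<sigma>[OF j \<pi>'])
      show "\<omega> \<in> set_pmf (law M k \<pi>' x)" using \<omega> P by simp
      show "(\<lambda>\<omega> :: ('s, 'u) traj. ?rr (Suc j) \<omega> + risk_cost M (state j \<omega>) (\<pi> j (state j \<omega>) (?rr j \<omega>)))
        \<in> borel_measurable (filtration (Suc j))"
      proof (rule borel_measurable_filtration)
        fix \<omega>1 \<omega>2 :: "('s, 'u) traj"
        assume *: "\<And>i. i < Suc j \<Longrightarrow> \<omega>1 i = \<omega>2 i" "state (Suc j) \<omega>1 = state (Suc j) \<omega>2"
        then have "?rr (Suc j) \<omega>1 = ?rr (Suc j) \<omega>2" "?rr j \<omega>1 = ?rr j \<omega>2" "state j \<omega>1 = state j \<omega>2"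
          by (auto intro!: threshold_depends simp: state_def)
        then show "?rr (Suc j) \<omega>1 + risk_cost M (state j \<omega>1) (\<pi> j (state j \<omega>1) (?rr j \<omega>1)) =
          ?rr (Suc j) \<omega>2 + risk_cost M (state j \<omega>2) (\<pi> j (state j \<omega>2) (?rr j \<omega>2))"
          by simp
      qed
      fix \<omega>' assume *: "\<And>i. i \<le> j \<Longrightarrow> \<omega>' i = \<omega> i"
      then have "?rr j \<omega>' = ?rr j \<omega>" "state j \<omega>' = state j \<omega>"
        by (auto intro!: threshold_depends simp: state_def)
      then show "?rr (Suc j) \<omega>' + risk_cost M (state j \<omega>') (\<pi> j (state j \<omega>') (?rr j \<omega>')) =
        risk_cost M ?x (\<pi> j ?x ?r) + (upd (Suc j) ?x ?r (state (Suc j) \<omega>') + ?r)"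
        using threshold_Suc[OF j(1), of upd r \<omega>'] by simp
    qed
    then show ?thesis by (simp add: P u \<sigma>_add stage_constraint_def)
  qed
  then show ?thesis using True unfolding feasible_def constraints_def Let_def AE_measure_pmf_iff
    by (simp add: Ball_def) blast
next
  case False
  then show ?thesis by (auto simp: feasible_def)
qed

text \<open>\<open>updates\<close> forces membership in \<open>\<Phi>\<close> at every successor,
  whereas the constraints pass only to successors of positive probability.\<close>

lemma feasible_Suc:
  assumes "k < horizon M" "r \<in> \<Phi> M k x" "feasible M k x r \<pi> upd"
  shows "upd (Suc k) x r y + r \<in> \<Phi> M (Suc k) y"
    and "y \<in> set_pmf (kernel M x (\<pi> k x r)) \<Longrightarrow> feasible M (Suc k) y (upd (Suc k) x r y + r) \<pi> upd"
proof -
  have *: "\<pi> \<in> aug_policies M k" "upd \<in> updates M k" "constraints \<pi> upd k x r"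
    using assms feasible_iff[of k r x] by auto
  show \<Phi>: "upd (Suc k) x r y + r \<in> \<Phi> M (Suc k) y"
    using *(2) assms by (auto simp: updates_def)
  show "feasible M (Suc k) y (upd (Suc k) x r y + r) \<pi> upd" if "y \<in> set_pmf (kernel M x (\<pi> k x r))"
    using * that constraints_first_step[OF assms(1)] feasible_iff[OF _ \<Phi>] assms(1)
      aug_policies_mono[of k "Suc k" M] updates_mono[of k "Suc k" M] by auto
qed

lemma feasible_stage:
  assumes "k < horizon M" "r \<in> \<Phi> M k x" "feasible M k x r \<pi> upd"
  shows "\<pi> k x r \<in> adm M x" "stage_constraint \<pi> upd k x r"
  using assms feasible_iff[of k r x] constraints_first_step[OF assms(1)]
  by (auto simp: aug_policies_def)

lemma R_le_of_stage_constraint: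
  assumes "stage_constraint \<pi> upd k x r" and "\<And>y. f y \<le> upd (Suc k) x r y + r"
  shows "risk_cost M x (\<pi> k x r) + \<sigma> k f x (kernel M x (\<pi> k x r)) \<le> r"
  using assms(1) \<sigma>_mono[of f "\<lambda>y. upd (Suc k) x r y + r", OF assms(2), of k x]
  unfolding stage_constraint_def by (smt (verit))

lemma sum_pmf_cong:
  assumes "\<And>y. y \<in> set_pmf q \<Longrightarrow> f y = g y"
  shows "(\<Sum>y\<in>UNIV. pmf q y * f y) = (\<Sum>y\<in>UNIV. pmf q y * (g y :: real))"
  using assms by (intro sum.cong refl) (metis mult_zero_left set_pmf_iff)

text \<open>The witness is glued from continuations: the constraints do not bound the risk of the
  induced policy off the support, and there membership in \<open>\<Phi>\<close> supplies a policy
  below the threshold.\<close>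

lemma policy_of_feasible:
  assumes "k \<le> horizon M" "r \<in> \<Phi> M k x" "feasible M k x r \<pi> upd"
  shows "\<exists>\<pi>' \<in> policies M k. R M k \<pi>' x \<le> r \<and> J M k \<pi>' x = J_aug M k x r \<pi> upd"
  using assms
proof (induction arbitrary: x r rule: inc_induct)
  case base
  then show ?case using policies_nonempty by (auto simp: \<Phi>_def R_horizon J_horizon J_aug_horizon)
next
  case (step k)
  note k = step.hyps(2)
  let ?u = "\<pi> k x r" and ?r = "\<lambda>y. upd (Suc k) x r y + r"
  \<comment> \<open>\<open>\<sigma>\<close> is monotone only for pointwise order, so successors of probability \<open>0\<close> need a policy as well\<close>
  have "\<exists>p \<in> policies M (Suc k). R M (Suc k) p y \<le> ?r y \<and>
    (y \<in> set_pmf (kernel M x ?u) \<longrightarrow> J M (Suc k) p y = J_aug M (Suc k) y (?r y) \<pi> upd)" for y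
    using step.IH[of "?r y" y] feasible_Suc[OF k step.prems, of y] \<Phi>_iff[of "Suc k" "?r y" y] k
    by (cases "y \<in> set_pmf (kernel M x ?u)") auto
  then obtain p where p: "\<And>y. p y \<in> policies M (Suc k)" "\<And>y. R M (Suc k) (p y) y \<le> ?r y"
    "\<And>y. y \<in> set_pmf (kernel M x ?u) \<Longrightarrow> J M (Suc k) (p y) y = J_aug M (Suc k) y (?r y) \<pi> upd"
    by metis
  obtain \<pi>' where \<pi>': "\<pi>' \<in> policies M k"
    "R M k \<pi>' x = risk_cost M x ?u + \<sigma> k (\<lambda>y. R M (Suc k) (p y) y) x (kernel M x ?u)"
    "J M k \<pi>' x = cost M x ?u + (\<Sum>y\<in>UNIV. pmf (kernel M x ?u) y * J M (Suc k) (p y) y)"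
    using combine_policies[where p = p, OF k feasible_stage(1)[OF k step.prems] p(1)] by blast
  have "R M k \<pi>' x \<le> r"
    unfolding \<pi>'(2) by (rule R_le_of_stage_constraint[OF feasible_stage(2)[OF k step.prems] p(2)])
  moreover have "J M k \<pi>' x = J_aug M k x r \<pi> upd"
    unfolding \<pi>'(3) J_aug_first_step[OF k] using p(3) by (simp cong: sum_pmf_cong)
  ultimately show ?case using \<pi>'(1) by blast
qed

lemma min_cost_le_J_aug:
  assumes "k \<le> horizon M" "r \<in> \<Phi> M k x" "feasible M k x r \<pi> upd"
  shows "min_cost k x r \<le> J_aug M k x r \<pi> upd"
  using policy_of_feasible[OF assms] min_cost_le[OF assms(1)] by fastforce

section \<open>Dynamic programming\<close>

text \<open>An optimal policy supplies the first control \<open>u\<close>, and its continuation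
  certifies the thresholds \<open>s\<close>: its risk is at most \<open>s y\<close>, so its cost is
  at least the minimum there.\<close>

lemma bellman_step:
  assumes k: "k < horizon M" and r: "r \<in> \<Phi> M k x"
  shows "\<exists>u s. u \<in> adm M x \<and> (\<forall>y. s y \<in> \<Phi> M (Suc k) y) \<and>
    risk_cost M x u + \<sigma> k s x (kernel M x u) = r \<and>
    cost M x u + (\<Sum>y\<in>UNIV. pmf (kernel M x u) y * min_cost (Suc k) y (s y)) \<le> min_cost k x r"
proof -
  obtain \<pi> where \<pi>: "\<pi> \<in> policies M k" "R M k \<pi> x \<le> r" "J M k \<pi> x = min_cost k x r"
    using min_cost_attained[of k r x] k r by auto
  define u where "u = \<pi> k ([], x)"
  define \<pi>' where "\<pi>' = after [(x, u)] \<pi>"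
  \<comment> \<open>the slack in the risk constraint is passed on to all successors, by translation equivariance\<close>
  define s where "s y = (r - R M k \<pi> x) + R M (Suc k) \<pi>' y" for y
  have \<pi>': "\<pi>' \<in> policies M (Suc k)" unfolding \<pi>'_def by (rule after_in_policies[OF \<pi>(1)])
  have s: "R M (Suc k) \<pi>' y \<le> s y" for y using \<pi>(2) by (simp add: s_def)
  have "u \<in> adm M x" using \<pi>(1) unfolding policies_def u_def by fastforce
  moreover have "s y \<in> \<Phi> M (Suc k) y" for y
    using \<Phi>_iff[of "Suc k" "s y" y] \<pi>' s k by auto
  moreover have "risk_cost M x u + \<sigma> k s x (kernel M x u) = r"
    unfolding s_def using R_first_step[OF \<pi>(1) k u_def] by (simp add: \<sigma>_add \<pi>'_def)
  moreover have "(\<Sum>y\<in>UNIV. pmf (kernel M x u) y * min_cost (Suc k) y (s y)) \<le>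
    (\<Sum>y\<in>UNIV. pmf (kernel M x u) y * J M (Suc k) \<pi>' y)"
    using min_cost_le[OF _ \<pi>' s] k by (intro sum_mono mult_left_mono) auto
  then have "cost M x u + (\<Sum>y\<in>UNIV. pmf (kernel M x u) y * min_cost (Suc k) y (s y)) \<le> min_cost k x r"
    using J_first_step[where \<pi> = \<pi> and x = x, OF k u_def] \<pi>(3) by (simp add: \<pi>'_def)
  ultimately show ?thesis by blast
qed

text \<open>Choice applied to \<open>bellman_step\<close> gives one control and one threshold family
  for all times, states and thresholds; backward induction accumulates the one-step
  inequalities.\<close>

lemma optimal_augmented_exists:
  "\<exists>\<pi> upd. \<forall>k x r. k \<le> horizon M \<longrightarrow> r \<in> \<Phi> M k x \<longrightarrow>
    feasible M k x r \<pi> upd \<and> J_aug M k x r \<pi> upd \<le> min_cost k x r"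
proof -
  have "\<forall>k x r. \<exists>u s. k < horizon M \<longrightarrow> r \<in> \<Phi> M k x \<longrightarrow>
    u \<in> adm M x \<and> (\<forall>y. s y \<in> \<Phi> M (Suc k) y) \<and>
    risk_cost M x u + \<sigma> k s x (kernel M x u) = r \<and>
    cost M x u + (\<Sum>y\<in>UNIV. pmf (kernel M x u) y * min_cost (Suc k) y (s y)) \<le> min_cost k x r"
    using bellman_step by blast
  then obtain \<pi> s where "\<forall>k x r. k < horizon M \<longrightarrow> r \<in> \<Phi> M k x \<longrightarrow>
    \<pi> k x r \<in> adm M x \<and> (\<forall>y. s k x r y \<in> \<Phi> M (Suc k) y) \<and>
    risk_cost M x (\<pi> k x r) + \<sigma> k (s k x r) x (kernel M x (\<pi> k x r)) = r \<and>
    cost M x (\<pi> k x r) + (\<Sum>y\<in>UNIV. pmf (kernel M x (\<pi> k x r)) y * min_cost (Suc k) y (s k x r y))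
      \<le> min_cost k x r"
    unfolding choice_iff by blast
  note \<pi>s = this[rule_format]
  \<comment> \<open>The update leading to time \<open>j\<close> is decided at \<open>j - 1\<close>
    and records an increment, hence the shift and the subtraction of \<open>r\<close>.\<close>
  define upd where "upd j x r y = s (j - 1) x r y - r" for j x r y
  have aug: "\<pi> \<in> aug_policies M k" for k using \<pi>s by (auto simp: aug_policies_def)
  have upd: "upd \<in> updates M k" for k using \<pi>s by (auto simp: updates_def upd_def)
  have "constraints \<pi> upd k x r \<and> J_aug M k x r \<pi> upd \<le> min_cost k x r"
    if "k \<le> horizon M" "r \<in> \<Phi> M k x" for k x r
    using that
  proof (induction arbitrary: x r rule: inc_induct)
    case base
    obtain p where "p \<in> policies M (horizon M)" "J M (horizon M) p x = min_cost (horizon M) x r"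
      using min_cost_attained[OF _ base] by auto
    then show ?case using base by (simp add: constraints_horizon J_aug_horizon J_horizon \<Phi>_def)
  next
    case (step k)
    note k = step.hyps(2)
    let ?u = "\<pi> k x r"
    note * = \<pi>s[OF k step.prems]
    have s: "upd (Suc k) x r y + r = s k x r y" for y by (simp add: upd_def)
    have "stage_constraint \<pi> upd k x r" using * by (simp add: stage_constraint_def s)
    then have "constraints \<pi> upd k x r"
      using step.IH * by (simp add: constraints_first_step[OF k] s)
    moreover have "(\<Sum>y\<in>UNIV. pmf (kernel M x ?u) y * J_aug M (Suc k) y (s k x r y) \<pi> upd) \<le>
      (\<Sum>y\<in>UNIV. pmf (kernel M x ?u) y * min_cost (Suc k) y (s k x r y))"
      using step.IH * by (intro sum_mono mult_left_mono) auto
    then have "J_aug M k x r \<pi> upd \<le> min_cost k x r"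
      using * by (simp add: J_aug_first_step[OF k] s)
    ultimately show ?case by simp
  qed
  then show ?thesis using aug upd feasible_iff by blast
qed

section \<open>Equality of the value functions\<close>

lemma VM_eq_V:
  assumes "k \<le> horizon M"
  shows "VM M k x r = V M k x r"
proof (cases "k < horizon M \<and> r \<in> \<Phi> M k x")
  case True
  then have r: "r \<in> \<Phi> M k x" by simp
  obtain \<pi> upd where *: "feasible M k x r \<pi> upd" "J_aug M k x r \<pi> upd \<le> min_cost k x r"
    using optimal_augmented_exists assms r by blast
  have "(INF (\<pi>, upd) \<in> {(\<pi>, upd). feasible M k x r \<pi> upd}. ereal (J_aug M k x r \<pi> upd)) =
    ereal (min_cost k x r)"
    (is "?I = _")
  proof (rule antisym)
    show "?I \<le> ereal (min_cost k x r)"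
      using * by (intro INF_lower2[of "(\<pi>, upd)"]) auto
  next
    show "ereal (min_cost k x r) \<le> ?I"
      using min_cost_le_J_aug[OF assms r] by (intro INF_greatest) auto
  qed
  then show ?thesis using True V_eq_min_cost by (simp add: VM_def)
next
  case False
  then show ?thesis by (auto simp: VM_def V_def)
qed

section \<open>Optimality of tails\<close>

text \<open>With \<open>min_cost\<close> attained by an augmented pair, optimality can be tested
  against history-dependent competitors, for which no updates have to be constructed.\<close>

lemma optimal_iff:
  assumes "k \<le> horizon M" "r \<in> \<Phi> M k x"
  shows "optimal M k x r \<pi> upd \<longleftrightarrow> feasible M k x r \<pi> upd \<and> J_aug M k x r \<pi> upd = min_cost k x r"
proof -
  obtain \<pi>' upd' where *: "feasible M k x r \<pi>' upd'" "J_aug M k x r \<pi>' upd' \<le> min_cost k x r"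
    using optimal_augmented_exists assms by blast
  show ?thesis
  proof
    assume opt: "optimal M k x r \<pi> upd"
    then have "J_aug M k x r \<pi> upd \<le> min_cost k x r"
      using * unfolding optimal_def by fastforce
    then show "feasible M k x r \<pi> upd \<and> J_aug M k x r \<pi> upd = min_cost k x r"
      using opt min_cost_le_J_aug[OF assms, of \<pi> upd] by (simp add: optimal_def)
  next
    assume "feasible M k x r \<pi> upd \<and> J_aug M k x r \<pi> upd = min_cost k x r"
    then show "optimal M k x r \<pi> upd"
      using min_cost_le_J_aug[OF assms] by (simp add: optimal_def)
  qed
qed

text \<open>The competitor keeps the first control and the prescribed thresholds but continues
  optimally at every successor. Optimality at \<open>k\<close> then bounds the weighted sum of the
  gaps \<open>?J y - ?m y\<close> by 0.\<close>

lemma optimal_Suc: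
  assumes k: "k < horizon M" and r: "r \<in> \<Phi> M k x" and opt: "optimal M k x r \<pi> upd"
    and y: "y \<in> set_pmf (kernel M x (\<pi> k x r))"
  shows "optimal M (Suc k) y (upd (Suc k) x r y + r) \<pi> upd"
proof -
  let ?u = "\<pi> k x r" and ?r = "\<lambda>y. upd (Suc k) x r y + r"
  let ?q = "kernel M x ?u"
  let ?J = "\<lambda>y. J_aug M (Suc k) y (?r y) \<pi> upd" and ?m = "\<lambda>y. min_cost (Suc k) y (?r y)"
  have feas: "feasible M k x r \<pi> upd" and J: "J_aug M k x r \<pi> upd = min_cost k x r"
    using optimal_iff[THEN iffD1, OF less_imp_le[OF k] r opt] by simp_all
  have k': "Suc k \<le> horizon M" using k by simp
  note \<Phi>' = feasible_Suc(1)[OF k r feas] and feas' = feasible_Suc(2)[OF k r feas]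
  have "\<exists>p \<in> policies M (Suc k). R M (Suc k) p y \<le> ?r y \<and> J M (Suc k) p y = ?m y" for y
    using min_cost_attained[OF k' \<Phi>'[of y]] by blast
  then obtain p where p: "\<And>y. p y \<in> policies M (Suc k)" "\<And>y. R M (Suc k) (p y) y \<le> ?r y"
    "\<And>y. J M (Suc k) (p y) y = ?m y"
    by metis
  obtain \<pi>' where \<pi>': "\<pi>' \<in> policies M k"
    "R M k \<pi>' x = risk_cost M x ?u + \<sigma> k (\<lambda>y. R M (Suc k) (p y) y) x ?q"
    "J M k \<pi>' x = cost M x ?u + (\<Sum>y\<in>UNIV. pmf ?q y * J M (Suc k) (p y) y)"
    using combine_policies[where p = p, OF k feasible_stage(1)[OF k r feas] p(1)] by blast
  have "R M k \<pi>' x \<le> r"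
    unfolding \<pi>'(2) by (rule R_le_of_stage_constraint[OF feasible_stage(2)[OF k r feas] p(2)])
  then have "min_cost k x r \<le> cost M x ?u + (\<Sum>y\<in>UNIV. pmf ?q y * ?m y)"
    using min_cost_le[of k \<pi>' x r] k \<pi>' p(3) by simp
  then have "(\<Sum>y\<in>UNIV. pmf ?q y * (?J y - ?m y)) \<le> 0"
    using J J_aug_first_step[OF k, of x r \<pi> upd] by (simp add: right_diff_distrib sum_subtractf)
  \<comment> \<open>On the support the tail is feasible and costs at least the minimum; off the
    support the weight is 0.\<close>
  moreover have nonneg: "0 \<le> pmf ?q y * (?J y - ?m y)" for y
    using min_cost_le_J_aug[OF k' \<Phi>' feas', of y] by (cases "y \<in> set_pmf ?q") (auto simp: set_pmf_iff)
  ultimately have "(\<Sum>y\<in>UNIV. pmf ?q y * (?J y - ?m y)) = 0"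
    by (intro antisym sum_nonneg) auto
  then have "pmf ?q y * (?J y - ?m y) = 0"
    using nonneg by (simp add: sum_nonneg_eq_0_iff)
  then have "?J y = ?m y" using y by (simp add: set_pmf_iff)
  then show ?thesis using optimal_iff[OF k' \<Phi>'] feas'[OF y] by simp
qed

text \<open>Induction along a fixed trajectory of the support: each of its transitions has positive
  probability, as \<open>optimal_Suc\<close> requires.\<close>

lemma time_consistent: "time_consistent M"
  unfolding time_consistent_def AE_measure_pmf_iff
proof (intro allI ballI impI)
  fix x r \<pi> upd k \<omega>
  assume r: "r \<in> \<Phi> M 0 x" and opt: "optimal M 0 x r \<pi> upd"
    and k: "k < horizon M" and \<omega>: "\<omega> \<in> set_pmf (aug_law M 0 x r \<pi> upd)"
  note supp = law_support[OF le0 \<omega>[unfolded aug_law_def]]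
  have upd: "upd \<in> updates M 0" using opt by (simp add: optimal_def feasible_def)
  have \<Phi>: "threshold upd 0 r j \<omega> \<in> \<Phi> M j (state j \<omega>)" if "j < horizon M" for j
    using threshold_in_\<Phi>[OF upd, of r \<omega> j] supp r that by simp
  have "optimal M k (state k \<omega>) (threshold upd 0 r k \<omega>) \<pi> upd"
    using k
  proof (induction k)
    case 0
    then show ?case using supp opt by simp
  next
    case (Suc k)
    then have "state (Suc k) \<omega> \<in> set_pmf (kernel M (state k \<omega>) (\<pi> k (state k \<omega>) (threshold upd 0 r k \<omega>)))"
      using supp by (simp add: control_induced)
    then show ?case
      using optimal_Suc[OF _ \<Phi>] Suc by (simp add: threshold_Suc)
  qed
  then show "threshold upd 0 r k \<omega> \<in> \<Phi> M k (state k \<omega>) \<and>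
    optimal M k (state k \<omega>) (threshold upd 0 r k \<omega>) \<pi> upd"
    using \<Phi>[OF k] by simp
qed

end

theorem mainTheorem2:
  fixes M :: "('s::finite, 'u::finite) problem"
  assumes "\<forall>x. adm M x \<noteq> {}"
    and "horizon M \<ge> 1"
    and "1 \<le> exponent M"
    and "markov_dynamic_risk M"
  shows "(\<forall>k \<le> horizon M. \<forall>x r. VM M k x r = V M k x r) \<and> time_consistent M"
proof -
  obtain \<sigma> where \<sigma>: "\<And>j x q. coherent_functional (\<lambda>f. \<sigma> j f x q)"
    and risk: "\<forall>k < horizon M. \<forall>x. \<forall>\<pi> \<in> policies M k. \<forall>j \<in> {k..<horizon M}.
      coherent_one_step (exponent M) (measure_pmf (law M k \<pi> x)) (filtration j) (filtration (Suc j))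
        (risk M (law M k \<pi> x) j) \<and>
      (\<forall>f. \<forall>\<omega> \<in> set_pmf (law M k \<pi> x). risk M (law M k \<pi> x) j (\<lambda>\<omega>. f (state (Suc j) \<omega>)) \<omega> =
        \<sigma> j f (state j \<omega>) (kernel M (state j \<omega>) (control \<pi> k j \<omega>)))"
    using assms(4) unfolding markov_dynamic_risk_def Let_def AE_measure_pmf_iff by blast
  interpret markov_risk_mdp M \<sigma>
  proof
    fix j k x \<pi>
    assume k: "k \<le> j" "j < horizon M" "\<pi> \<in> policies M k"
    then have "k < horizon M" "j \<in> {k..<horizon M}" by auto
    note * = risk[rule_format, OF this(1) k(3) this(2), of x]
    show "coherent_one_step (exponent M) (measure_pmf (law M k \<pi> x)) (filtration j) (filtration (Suc j))
        (risk M (law M k \<pi> x) j)"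
      using * by (rule conjunct1)
    show "risk M (law M k \<pi> x) j (\<lambda>\<omega>. f (state (Suc j) \<omega>)) \<omega> =
        \<sigma> j f (state j \<omega>) (kernel M (state j \<omega>) (control \<pi> k j \<omega>))"
      if "\<omega> \<in> set_pmf (law M k \<pi> x)" for f \<omega>
      using *[THEN conjunct2] that by blast
  qed (use assms(1) \<sigma> in auto)
  show ?thesis using VM_eq_V time_consistent by blast
qed

end
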